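(* Suppose $\mathcal G$ is undirected and connected, each $f_i$ is $L_i$-smooth and $\mu_i$-strongly convex with $\mu_i>0$, and for each agent $i$ there is a constant $\xi_i\ge0$ such that $$\Big\|\sum_{j}w_{ij}(\bm y_j^k-\bm y_i^k)\Big\|\le \xi_i\,\|\bm x_i^{k+1}-\bm x_i^k\|\qquad\text{whenever }\|\bm x_i^{k+1}-\bm x_i^k\|>0$$ (the relative tracking-disagreement condition). Assume the quantities required by the stepsize update at $k=0$ are well defined (i.e. $\bm x_i^1\ne\bm x_i^0$ for every $i$) and $\alpha_i^0\ge \frac{1}{2\gamma L_i}$ for every $i$. Let $L=\max_iL_i$, $\mu=\min_i\mu_i$ and $$\underline\alpha=\frac{1}{2\gamma\max_i(L_i+\xi_i)} .$$ For $a>0$ let $$M(a)=\begin{bmatrix}\lambda+\lambda aL & \lambda a & \sqrt n\,\lambda aL\\ L(|||W-I|||+La) & \lambda+La & \sqrt n\,L^2a\\ \frac{La}{\sqrt n} & \frac{a}{\sqrt n} & 1-\mu\underline\alpha\end{bmatrix}.$$ (A) Let the iterates be generated by AdGT with the combined update $\alpha_i^{k+1}=\min\{\frac{1}{2\gamma L_{f_i}^k},\frac{1}{2\gamma L_{y_i}^k},\sqrt{1+\theta_i^k}\,\alpha_i^k\}$. Then $$\frac{1}{2\gamma(L_i+\xi_i)}\le\alpha_i^k\le\frac{1}{2\gamma\mu_i},\qquad i\in\mathcal V,\ k\ge1 .$$ If moreover $\gamma\ge L/\mu$ and $\rho\big(M(\tfrac{1}{2\gamma\mu})\big)<1$, then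 $\mathbf x^k$ converges linearly to $\mathbf 1\bm x^*$ with a rate arbitrarily close to $\rho\big(M(\tfrac{1}{2\gamma\mu})\big)$. (B) Let the iterates be generated by AdGT with the tracking update $\alpha_i^{k+1}=\min\{\frac{1}{2\gamma L_{y_i}^k},\sqrt{1+\theta_i^k}\,\alpha_i^k\}$. Then $\alpha_i^k\ge\frac{1}{2\gamma(L_i+\xi_i)}$ for all $i\in\mathcal V$, $k\ge1$. If, in addition, $\xi_i<\mu_i$ for every agent, then $$\frac{1}{2\gamma(L_i+\xi_i)}\le\alpha_i^k\le\frac{1}{2\gamma(\mu_i-\xi_i)},\qquad i\in\mathcal V,\ k\ge1 ,$$ and, with $a=\frac{1}{2\gamma\min_i(\mu_i-\xi_i)}$, if $\gamma\ge\frac{L}{\min_i(\mu_i-\xi_i)}$ and $\rho(M(a))<1$, then $\mathbf x^k$ converges linearly to $\mathbf 1\bm x^*$ with a rate arbitrarily close to $\rho(M(a))$.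
   Context: Problem. Let $\mathcal G=(\mathcal V,\mathcal E)$, $\mathcal V=\{1,\dots,n\}$, be an undirected connected graph, and let $\mathcal N_i=\{j:(j,i)\in\mathcal E\}\cup\{i\}$. $W=[w_{ij}]\in\mathbb R^{n\times n}$ is a symmetric doubly stochastic matrix with $w_{ij}>0$ if $j\in\mathcal N_i$ and $w_{ij}=0$ otherwise. Each agent $i$ has a function $f_i:\mathbb R^p\to\mathbb R$. The function $f_i$ is $L_i$-smooth if it is differentiable with $\|\nabla f_i(\bm x)-\nabla f_i(\bm x')\|\le L_i\|\bm x-\bm x'\|$ for all $\bm x,\bm x'$; it is $\mu_i$-strongly convex if $f_i(\bm y)\ge f_i(\bm x)+\nabla f_i(\bm x)^\top(\bm y-\bm x)+\frac{\mu_i}{2}\|\bm y-\bm x\|^2$ for all $\bm x,\bm y$. $\bm x^*$ denotes the unique minimizer of $\frac1n\sum_{i=1}^n f_i$. Algorithm AdGT. Given $\gamma>0$ (a common safety factor), $\bm x_i^0\in\mathbb R^p$, $\bm y_i^0=\nabla f_i(\bm x_i^0)$, $\alpha_i^0>0$, $\theta_i^0=0$, for $k=0,1,\dots$ every agent $i$ computes $$\bm x_i^{k+1}=\sum_{j\in\mathcal N_i}w_{ij}(\bm x_j^k-\alpha_j^k\bm y_j^k),\qquad \bm y_i^{k+1}=\sum_{j\in\mathcal N_i}w_{ij}\bm y_j^k+\nabla f_i(\bm x_i^{k+1})-\nabla f_i(\bm x_i^k),$$ then $\alpha_i^{k+1}$ by the stated stepsize update, and $\theta_i^{k+1}=\alpha_i^{k+1}/\alpha_i^k$.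 Here $$L_{f_i}^k=\frac{\|\nabla f_i(\bm x_i^{k+1})-\nabla f_i(\bm x_i^k)\|}{\|\bm x_i^{k+1}-\bm x_i^k\|},\qquad L_{y_i}^k=\frac{\|\bm y_i^{k+1}-\bm y_i^k\|}{\|\bm x_i^{k+1}-\bm x_i^k\|}.$$ Conventions: if $\bm x_i^{k+1}=\bm x_i^k$ for some $k\ge1$, set $\alpha_i^{k+1}=\alpha_i^k$; if the denominator is nonzero but $L_{f_i}^k=0$ or $L_{y_i}^k=0$, the corresponding candidate $\frac{1}{2\gamma L_{f_i}^k}$ or $\frac1{2\gamma L_{y_i}^k}$ is interpreted as $+\infty$ (omitted from the minimum). Notation. $\|\cdot\|$ is the Euclidean norm for vectors and the Frobenius norm for matrices; $|||\cdot|||$ is the spectral norm; $\rho(\cdot)$ is the spectral radius; $\mathbf 1\in\mathbb R^n$ is the all-ones column vector. $\mathbf x^k\in\mathbb R^{n\times p}$ has rows $(\bm x_i^k)^\top$, and $\mathbf 1\bm x^*$ denotes the $n\times p$ matrix all of whose rows equal $\bm x^*$. With $\lambda_1\ge\dots\ge\lambda_n$ the eigenvalues of $W$, $\lambda=\max\{|\lambda_2|,|\lambda_n|\}=|||W-\frac1n\mathbf 1\mathbf 1^\top|||<1$. "$\mathbf x^k$ converges linearly to $\mathbf 1\bm x^*$ with a rate arbitrarily close to $r$" (where $r<1$) means: for every $\zeta\in(0,1-r)$ there is a constant $C\ge0$ with $\|\mathbf x^k-\mathbf 1\bm x^*\|\le C(r+\zeta)^{k-1}$ for all $k\ge1$.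 *)

theory Defs
  imports "Jordan_Normal_Form.Spectral_Radius" "HOL-Analysis.Analysis"
begin

text \<open>\<open>$\<close> and \<open>\<bullet>\<close> denote the operations of \<open>HOL-Analysis\<close> below.\<close>

no_notation Matrix.vec_index (infixl \<open>$\<close> 100)
no_notation Matrix.scalar_prod (infix \<open>\<bullet>\<close> 70)

text \<open>
  Agents are the elements of a finite type \<open>'n\<close>.  A stacked variable is an element of
  \<open>real ^ 'p ^ 'n\<close>, whose \<open>i\<close>-th row is the vector held by agent \<open>i\<close>;
  its library \<open>norm\<close> is the Frobenius norm.
\<close>

definition connected_graph :: "('n \<times> 'n) set \<Rightarrow> bool" where
  "connected_graph E \<longleftrightarrow> (\<forall>i j. (i, j) \<in> E\<^sup>*)"

definition nbhd :: "('n \<times> 'n) set \<Rightarrow> 'n \<Rightarrow> 'n set" where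
  "nbhd E i = {j. (j, i) \<in> E} \<union> {i}"

definition mixing_matrix :: "('n \<times> 'n) set \<Rightarrow> real ^ 'n ^ 'n \<Rightarrow> bool" where
  "mixing_matrix E W \<longleftrightarrow>
     Finite_Cartesian_Product.transpose W = W \<and>
     (\<forall>i j. W $ i $ j \<ge> 0) \<and>
     (\<forall>i. (\<Sum>j\<in>UNIV. W $ i $ j) = 1) \<and>
     (\<forall>j. (\<Sum>i\<in>UNIV. W $ i $ j) = 1) \<and>
     (\<forall>i j. (j \<in> nbhd E i \<longrightarrow> W $ i $ j > 0) \<and> (j \<notin> nbhd E i \<longrightarrow> W $ i $ j = 0))"

definition grad :: "('a::real_inner \<Rightarrow> real) \<Rightarrow> 'a \<Rightarrow> 'a" where
  "grad f x = (THE D. GDERIV f x :> D)"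

definition L_smooth :: "real \<Rightarrow> ('a::real_inner \<Rightarrow> real) \<Rightarrow> bool" where
  "L_smooth L f \<longleftrightarrow>
     (\<forall>x. f differentiable (at x)) \<and>
     (\<forall>x x'. norm (grad f x - grad f x') \<le> L * norm (x - x'))"

text \<open>Only used for differentiable \<open>f\<close>, where \<open>grad f\<close> is the gradient.\<close>

definition strongly_convex :: "real \<Rightarrow> ('a::real_inner \<Rightarrow> real) \<Rightarrow> bool" where
  "strongly_convex \<mu> f \<longleftrightarrow>
     (\<forall>x y. f y \<ge> f x + grad f x \<bullet> (y - x) + \<mu> / 2 * (norm (y - x))\<^sup>2)"

text \<open>The unique minimizer of the average; it exists when every \<open>f i\<close> is
  smooth and strongly convex with positive modulus.\<close>

definition avg_minimizer :: "('n::finite \<Rightarrow> 'a \<Rightarrow> real) \<Rightarrow> 'a" where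
  "avg_minimizer f =
     (THE z. \<forall>y. (\<Sum>i\<in>UNIV. f i z) / real CARD('n) \<le> (\<Sum>i\<in>UNIV. f i y) / real CARD('n))"

definition spectral_norm :: "real ^ 'n ^ 'n \<Rightarrow> real" where
  "spectral_norm A = onorm (\<lambda>v. A *v v)"

text \<open>For a mixing matrix of a connected graph with eigenvalues
  \<open>\<lambda>\<^sub>1 \<ge> \<dots> \<ge> \<lambda>\<^sub>n\<close>, \<open>n \<ge> 2\<close>, this is
  \<open>max {\<bar>\<lambda>\<^sub>2\<bar>, \<bar>\<lambda>\<^sub>n\<bar>}\<close>; for \<open>n = 1\<close> it is 0.\<close>

definition mixing_rate :: "real ^ 'n ^ 'n \<Rightarrow> real" where
  "mixing_rate W = spectral_norm (W - (\<chi> i j. 1 / real CARD('n)))"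

text \<open>An empty set of candidates encodes the value \<open>+\<infinity>\<close>.\<close>

definition candidate :: "real \<Rightarrow> real \<Rightarrow> real set" where
  "candidate \<gamma> l = (if l = 0 then {} else {1 / (2 * \<gamma> * l)})"

definition Lf_est ::
  "('n \<Rightarrow> real ^ 'p \<Rightarrow> real) \<Rightarrow> (nat \<Rightarrow> real ^ 'p ^ 'n) \<Rightarrow> nat \<Rightarrow> 'n \<Rightarrow> real" where
  "Lf_est f x k i =
     norm (grad (f i) (x (Suc k) $ i) - grad (f i) (x k $ i)) / norm (x (Suc k) $ i - x k $ i)"

definition Ly_est ::
  "(nat \<Rightarrow> real ^ 'p ^ 'n) \<Rightarrow> (nat \<Rightarrow> real ^ 'p ^ 'n) \<Rightarrow> nat \<Rightarrow> 'n \<Rightarrow> real" where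
  "Ly_est x y k i = norm (y (Suc k) $ i - y k $ i) / norm (x (Suc k) $ i - x k $ i)"

text \<open>Everything in AdGT except the rule for the next stepsize.\<close>

definition AdGT_common ::
  "('n::finite \<times> 'n) set \<Rightarrow> real ^ 'n ^ 'n \<Rightarrow> ('n \<Rightarrow> real ^ 'p \<Rightarrow> real) \<Rightarrow>
   (nat \<Rightarrow> real ^ 'p ^ 'n) \<Rightarrow> (nat \<Rightarrow> real ^ 'p ^ 'n) \<Rightarrow>
   (nat \<Rightarrow> 'n \<Rightarrow> real) \<Rightarrow> (nat \<Rightarrow> 'n \<Rightarrow> real) \<Rightarrow> bool" where
  "AdGT_common E W f x y \<alpha> \<theta> \<longleftrightarrow>
     (\<forall>i. y 0 $ i = grad (f i) (x 0 $ i)) \<and>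
     (\<forall>i. \<alpha> 0 i > 0) \<and>
     (\<forall>i. \<theta> 0 i = 0) \<and>
     (\<forall>k i. x (Suc k) $ i =
        (\<Sum>j\<in>nbhd E i. W $ i $ j *\<^sub>R (x k $ j - \<alpha> k j *\<^sub>R y k $ j))) \<and>
     (\<forall>k i. y (Suc k) $ i =
        (\<Sum>j\<in>nbhd E i. W $ i $ j *\<^sub>R y k $ j)
        + grad (f i) (x (Suc k) $ i) - grad (f i) (x k $ i)) \<and>
     (\<forall>k i. \<theta> (Suc k) i = \<alpha> (Suc k) i / \<alpha> k i)"

definition combined_update ::
  "real \<Rightarrow> ('n \<Rightarrow> real ^ 'p \<Rightarrow> real) \<Rightarrow>
   (nat \<Rightarrow> real ^ 'p ^ 'n) \<Rightarrow> (nat \<Rightarrow> real ^ 'p ^ 'n) \<Rightarrow>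
   (nat \<Rightarrow> 'n \<Rightarrow> real) \<Rightarrow> (nat \<Rightarrow> 'n \<Rightarrow> real) \<Rightarrow> bool" where
  "combined_update \<gamma> f x y \<alpha> \<theta> \<longleftrightarrow>
     (\<forall>k i. \<alpha> (Suc k) i =
        (if x (Suc k) $ i = x k $ i then \<alpha> k i
         else Min (candidate \<gamma> (Lf_est f x k i) \<union> candidate \<gamma> (Ly_est x y k i)
                   \<union> {sqrt (1 + \<theta> k i) * \<alpha> k i})))"

definition tracking_update ::
  "real \<Rightarrow>
   (nat \<Rightarrow> real ^ 'p ^ 'n) \<Rightarrow> (nat \<Rightarrow> real ^ 'p ^ 'n) \<Rightarrow>
   (nat \<Rightarrow> 'n \<Rightarrow> real) \<Rightarrow> (nat \<Rightarrow> 'n \<Rightarrow> real) \<Rightarrow> bool" where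
  "tracking_update \<gamma> x y \<alpha> \<theta> \<longleftrightarrow>
     (\<forall>k i. \<alpha> (Suc k) i =
        (if x (Suc k) $ i = x k $ i then \<alpha> k i
         else Min (candidate \<gamma> (Ly_est x y k i) \<union> {sqrt (1 + \<theta> k i) * \<alpha> k i})))"

definition AdGT_matrix ::
  "real ^ 'n ^ 'n \<Rightarrow> real \<Rightarrow> real \<Rightarrow> real \<Rightarrow> real \<Rightarrow> real mat" where
  "AdGT_matrix W L \<mu> \<alpha>_low a =
     (let lam = mixing_rate W; d = spectral_norm (W - Finite_Cartesian_Product.mat 1);
          n = real CARD('n)
      in mat_of_rows_list 3
           [[lam + lam * a * L,    lam * a,       sqrt n * lam * a * L],
            [L * (d + L * a),  lam + L * a,   sqrt n * L\<^sup>2 * a],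
            [L * a / sqrt n,   a / sqrt n,  1 - \<mu> * \<alpha>_low]])"

definition real_spectral_radius :: "real mat \<Rightarrow> real" where
  "real_spectral_radius A = spectral_radius (map_mat complex_of_real A)"

text \<open>Linear convergence with a rate arbitrarily close to \<open>r\<close>.\<close>

definition converges_linearly_near ::
  "(nat \<Rightarrow> 'a::real_normed_vector) \<Rightarrow> 'a \<Rightarrow> real \<Rightarrow> bool" where
  "converges_linearly_near X l r \<longleftrightarrow>
     (\<forall>\<zeta>. 0 < \<zeta> \<and> \<zeta> < 1 - r \<longrightarrow>
        (\<exists>C\<ge>0. \<forall>k\<ge>1. norm (X k - l) \<le> C * (r + \<zeta>) ^ (k - 1)))"

end

theory Submission
  imports Defs
begin

text \<open>
  Two independent facts give the result: the stepsizes stay in an interval that is known in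
  advance, and with any stepsizes from such an interval the errors of gradient tracking obey a linear
  recursion whose matrix depends on the stepsizes only through its end points.

  Stepsizes.  Between two consecutive iterates of one agent, smoothness and strong convexity squeeze
  the local estimate \<open>Lf_est\<close> between \<open>\<mu>\<^sub>i\<close> and
  \<open>L\<^sub>i\<close>.  The increment of the tracker is the gradient increment plus
  \<open>\<Sum>j. w\<^sub>i\<^sub>j (y\<^sub>j - y\<^sub>i)\<close>, so the disagreement condition puts
  \<open>Ly_est\<close> within \<open>\<xi>\<^sub>i\<close> of \<open>Lf_est\<close>
  (\<open>estimate_bounds\<close>).  Hence every curvature candidate is at least
  \<open>1 / (2 \<gamma> (L\<^sub>i + \<xi>\<^sub>i))\<close>, and the candidate
  \<open>sqrt (1 + \<theta>) \<alpha>\<close> never decreases the stepsize, which gives the lower bound (\<open>stepsize_lower_bound\<close>).  For the upper bound it is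
  enough that one candidate is small at the last iteration at which the agent moved, and the first
  iteration is one (\<open>stepsize_upper_bound\<close>).

  Contraction.  Three errors are followed: the consensus error of the \<open>x\<^sub>i\<close>, the
  consensus error of the \<open>y\<^sub>i\<close>, and the distance of the mean iterate from the minimizer.
  Averaging with \<open>W\<close> contracts the first two by \<open>\<lambda>\<close>.  The mean of the trackers
  is the mean of the local gradients, so the mean iterate performs a gradient step on the average
  objective, with the mean stepsize, perturbed by the two consensus errors.  For stepsizes at most
  \<open>1 / (2 L)\<close> the unperturbed gradient step contracts
  (\<open>gradient_step_contraction\<close>); this is where the lower bound on \<open>\<gamma>\<close>
  enters.  Together the three errors satisfy \<open>e (k + 1) \<le> M e k\<close> entrywise
  (\<open>gradient_tracking_step\<close>) with the nonnegative matrix \<open>M\<close> of the theorem, and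
  the powers of \<open>M / s\<close> are bounded for every \<open>s > \<rho> M\<close>
  (\<open>nonneg_comparison_geometric_bound\<close>).

  The gradients enter the contraction argument only through the lower quadratic bound and the
  Lipschitz bound, so its lemmas are stated for an arbitrary map \<open>g\<close> with these two
  properties.
\<close>

section \<open>Nonnegative comparison systems\<close>

text \<open>
  The induction applies the hypothesis to the shifted sequence \<open>w (k + 1)\<close>: the new factor
  \<open>B\<close> then acts on the initial vector, and the nonnegative power \<open>B\<^sup>k\<close>
  preserves the inequality.
\<close>

lemma nonneg_comparison_power_bound:
  fixes B :: "real mat" and w :: "nat \<Rightarrow> nat \<Rightarrow> real"
  assumes B: "B \<in> carrier_mat n n"
    and nonneg: "\<And>i j. i < n \<Longrightarrow> j < n \<Longrightarrow> 0 \<le> B $$ (i, j)"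
    and step: "\<And>k i. i < n \<Longrightarrow> w (Suc k) i \<le> (\<Sum>j<n. B $$ (i, j) * w k j)"
    and i: "i < n"
  shows "w k i \<le> (\<Sum>j<n. (B ^\<^sub>m k) $$ (i, j) * w 0 j)"
proof -
  have pow_entry: "(B ^\<^sub>m Suc m) $$ (i, j) = (\<Sum>l<n. (B ^\<^sub>m m) $$ (i, l) * B $$ (l, j))"
    if "i < n" "j < n" for m i j
    using that B pow_carrier_mat[OF B, of m]
    by (simp add: Matrix.scalar_prod_def lessThan_atLeast0)
  have pow_nonneg: "0 \<le> (B ^\<^sub>m m) $$ (i, j)" if "i < n" "j < n" for m i j
    using that
  proof (induction m arbitrary: i j)
    case 0
    then show ?case using B by simp
  next
    case (Suc m)
    show ?case unfolding pow_entry[OF Suc.prems]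
      using Suc nonneg by (intro sum_nonneg mult_nonneg_nonneg) auto
  qed
  show ?thesis using step i
  proof (induction k arbitrary: w i)
    case 0
    have "(\<Sum>j<n. (B ^\<^sub>m 0) $$ (i, j) * w 0 j) = (\<Sum>j<n. if j = i then w 0 j else 0)"
      using B 0 by (intro sum.cong) auto
    then show ?case using 0 by simp
  next
    case (Suc k)
    have "w (Suc k) i \<le> (\<Sum>l<n. (B ^\<^sub>m k) $$ (i, l) * w (Suc 0) l)"
      using Suc.IH[of "\<lambda>k. w (Suc k)" i] Suc.prems by simp
    also have "\<dots> \<le> (\<Sum>l<n. (B ^\<^sub>m k) $$ (i, l) * (\<Sum>j<n. B $$ (l, j) * w 0 j))"
      using Suc.prems pow_nonneg by (intro sum_mono mult_left_mono) auto
    also have "\<dots> = (\<Sum>j<n. \<Sum>l<n. (B ^\<^sub>m k) $$ (i, l) * B $$ (l, j) * w 0 j)"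
      by (subst sum.swap) (simp add: sum_distrib_left mult.assoc)
    also have "\<dots> = (\<Sum>j<n. (B ^\<^sub>m Suc k) $$ (i, j) * w 0 j)"
      using Suc.prems by (intro sum.cong) (simp_all only: pow_entry lessThan_iff sum_distrib_right)
    finally show ?case .
  qed
qed

lemma real_spectral_radius_bound:
  fixes A :: "real mat"
  assumes A: "A \<in> carrier_mat n n" and n: "0 < n"
  shows "0 \<le> real_spectral_radius A"
    and "eigenvalue (map_mat complex_of_real A) ev \<Longrightarrow> norm ev \<le> real_spectral_radius A"
proof -
  have AC: "map_mat complex_of_real A \<in> carrier_mat n n" using A by simp
  show "0 \<le> real_spectral_radius A"
    using spectral_radius_mem_max(1)[OF AC n] unfolding real_spectral_radius_def by auto
  show "eigenvalue (map_mat complex_of_real A) ev \<Longrightarrow> norm ev \<le> real_spectral_radius A"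
    using spectral_radius_mem_max(2)[OF AC n] unfolding real_spectral_radius_def spectrum_def by auto
qed

text \<open>
  Dividing by \<open>s\<close> turns \<open>A\<close> into a matrix of spectral radius below 1, whose powers
  are bounded by the Jordan normal form, and turns \<open>v k\<close> into \<open>v k / s\<^sup>k\<close>.
\<close>

lemma nonneg_comparison_geometric_bound:
  fixes A :: "real mat" and v :: "nat \<Rightarrow> nat \<Rightarrow> real"
  assumes A: "A \<in> carrier_mat n n" and n: "0 < n"
    and nonneg: "\<And>i j. i < n \<Longrightarrow> j < n \<Longrightarrow> 0 \<le> A $$ (i, j)"
    and step: "\<And>k i. i < n \<Longrightarrow> v (Suc k) i \<le> (\<Sum>j<n. A $$ (i, j) * v k j)"
    and s: "real_spectral_radius A < s"
  shows "\<exists>C\<ge>0. \<forall>k. \<forall>i<n. v k i \<le> C * s ^ k"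
proof -
  have s0: "0 < s" using real_spectral_radius_bound(1)[OF A n] s by linarith
  define B where "B = (1 / s) \<cdot>\<^sub>m A"
  have B: "B \<in> carrier_mat n n" using A by (simp add: B_def)
  have B_entry: "B $$ (i, j) = A $$ (i, j) / s" if "i < n" "j < n" for i j
    using that A by (simp add: B_def)
  define BC where "BC = map_mat complex_of_real B"
  define AC where "AC = map_mat complex_of_real A"
  have BC: "BC \<in> carrier_mat n n" and AC: "AC \<in> carrier_mat n n" using A B by (auto simp: BC_def AC_def)
  have BC_AC: "AC = complex_of_real s \<cdot>\<^sub>m BC"
    using A s0 by (intro eq_matI) (auto simp: AC_def BC_def B_def)
  have "spectral_radius BC < 1"
  proof -
    obtain ev where ev: "ev \<in> spectrum BC" "spectral_radius BC = norm ev"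
      using spectral_radius_mem_max(1)[OF BC n] by auto
    then obtain u where u: "u \<in> carrier_vec n" "u \<noteq> 0\<^sub>v n" "BC *\<^sub>v u = ev \<cdot>\<^sub>v u"
      using BC unfolding spectrum_def eigenvalue_def eigenvector_def by auto
    have "AC *\<^sub>v u = complex_of_real s \<cdot>\<^sub>v (BC *\<^sub>v u)"
      using BC u(1) unfolding BC_AC by (intro eq_vecI) auto
    also have "\<dots> = (complex_of_real s * ev) \<cdot>\<^sub>v u"
      using u by (simp add: smult_smult_assoc)
    finally have "eigenvalue AC (complex_of_real s * ev)"
      using u AC unfolding eigenvalue_def eigenvector_def by auto
    then have "norm (complex_of_real s * ev) \<le> real_spectral_radius A"
      unfolding AC_def by (rule real_spectral_radius_bound(2)[OF A n])
    then have "s * norm ev \<le> real_spectral_radius A" using s0 by (simp add: norm_mult)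
    then have "s * norm ev < s" using s by (rule le_less_trans)
    then show ?thesis using s0 ev(2) by simp
  qed
  then obtain c where c: "\<And>k. norm_bound (BC ^\<^sub>m k) c"
    using spectral_radius_jnf_norm_bound_less_1_upper_triangular[OF BC] by auto
  have pow_bound: "\<bar>(B ^\<^sub>m k) $$ (i, j)\<bar> \<le> c" if "i < n" "j < n" for k i j
  proof -
    have "BC ^\<^sub>m k = map_mat complex_of_real (B ^\<^sub>m k)"
      unfolding BC_def by (rule of_real_hom.mat_hom_pow[OF B, symmetric])
    then show ?thesis
      using c[of k] that B unfolding norm_bound_def by auto
  qed
  define w where "w k i = v k i / s ^ k" for k i
  have w_step: "w (Suc k) i \<le> (\<Sum>j<n. B $$ (i, j) * w k j)" if "i < n" for k i
  proof -
    have "w (Suc k) i \<le> (\<Sum>j<n. A $$ (i, j) * v k j) / s ^ Suc k"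
      unfolding w_def using step[OF that, of k] s0 by (intro divide_right_mono) auto
    also have "\<dots> = (\<Sum>j<n. B $$ (i, j) * w k j)"
      using that by (simp add: sum_divide_distrib B_entry w_def)
    finally show ?thesis .
  qed
  define C where "C = (\<Sum>j<n. c * \<bar>v 0 j\<bar>)"
  have c0: "0 \<le> c" using pow_bound[OF n n, of 0] by linarith
  have "v k i \<le> C * s ^ k" if i: "i < n" for k i
  proof -
    have "w k i \<le> (\<Sum>j<n. (B ^\<^sub>m k) $$ (i, j) * w 0 j)"
      using nonneg s0 by (intro nonneg_comparison_power_bound[where w = w, OF B _ w_step i]) (auto simp: B_entry)
    also have "\<dots> \<le> C" unfolding C_def
    proof (rule sum_mono)
      fix j assume "j \<in> {..<n}"
      then have "\<bar>(B ^\<^sub>m k) $$ (i, j)\<bar> * \<bar>v 0 j\<bar> \<le> c * \<bar>v 0 j\<bar>"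
        using pow_bound[OF i] by (intro mult_right_mono) auto
      then show "(B ^\<^sub>m k) $$ (i, j) * w 0 j \<le> c * \<bar>v 0 j\<bar>"
        by (simp add: w_def) (metis abs_le_D1 abs_mult)
    qed
    finally show ?thesis using s0 by (simp add: w_def divide_simps)
  qed
  moreover have "0 \<le> C" unfolding C_def using c0 by (intro sum_nonneg) auto
  ultimately show ?thesis by blast
qed

section \<open>Gradient steps on strongly convex functions\<close>

text \<open>
  The lower bound at \<open>y\<close> is an upper bound for \<open>F y\<close>, with the gradient taken at the
  wrong end point; replacing it by the gradient at \<open>x\<close> costs at most \<open>L (norm (y - x))\<^sup>2\<close>.
  The constant is twice the one that integration along the segment gives, which is harmless for
  stepsizes at most \<open>1 / (2 L)\<close>.
\<close>

lemma smooth_upper_bound: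
  fixes F :: "'a::real_inner \<Rightarrow> real"
  assumes conv: "\<And>x y. F y \<ge> F x + G x \<bullet> (y - x) + \<mu> / 2 * (norm (y - x))\<^sup>2"
    and lip: "\<And>x y. norm (G x - G y) \<le> L * norm (x - y)" and \<mu>: "0 \<le> \<mu>"
  shows "F y \<le> F x + G x \<bullet> (y - x) + L * (norm (y - x))\<^sup>2"
proof -
  have "F x \<ge> F y + G y \<bullet> (x - y) + \<mu> / 2 * (norm (x - y))\<^sup>2" by (rule conv)
  moreover have "0 \<le> \<mu> / 2 * (norm (x - y))\<^sup>2" using \<mu> by simp
  moreover have "(G y - G x) \<bullet> (y - x) = - (G y \<bullet> (x - y)) - G x \<bullet> (y - x)"
    by (simp add: algebra_simps)
  moreover have "(G y - G x) \<bullet> (y - x) \<le> norm (G y - G x) * norm (y - x)"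
    by (rule norm_cauchy_schwarz)
  moreover have "norm (G y - G x) * norm (y - x) \<le> L * norm (y - x) * norm (y - x)"
    by (rule mult_right_mono[OF lip]) simp
  ultimately show ?thesis unfolding power2_eq_square mult.assoc by linarith
qed

text \<open>
  Write \<open>h\<close> for \<open>F\<close> minus \<open>\<mu>/2\<close> times the squared norm; \<open>h\<close> is still
  convex.  With \<open>d = z - w\<close> and with \<open>q\<close> the difference of the gradients of \<open>h\<close>, the new
  difference is \<open>(1 - \<alpha> \<mu>) d - \<alpha> q\<close>, so the claim amounts to the
  cocoercivity estimate \<open>norm q ^ 2 \<le> 2 l (q \<bullet> d)\<close> for the constant
  \<open>l = 1 / \<alpha> - \<mu>\<close>.  It follows by comparing \<open>h\<close> at \<open>w\<close>, at \<open>z\<close>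
  and at the gradient step \<open>z - q / l\<close>.
\<close>

lemma gradient_step_contraction:
  fixes F :: "'a::real_inner \<Rightarrow> real"
  assumes conv: "\<And>x y. F y \<ge> F x + G x \<bullet> (y - x) + \<mu> / 2 * (norm (y - x))\<^sup>2"
    and lip: "\<And>x y. norm (G x - G y) \<le> L * norm (x - y)"
    and \<mu>: "0 \<le> \<mu>" and \<alpha>: "0 < \<alpha>" "2 * \<alpha> * L \<le> 1" and \<alpha>\<mu>: "\<alpha> * \<mu> < 1"
  shows "norm ((z - \<alpha> *\<^sub>R G z) - (w - \<alpha> *\<^sub>R G w)) \<le> (1 - \<alpha> * \<mu>) * norm (z - w)"
proof -
  \<comment> \<open>The largest constant for which the quadratic terms below cancel; the stepsize condition makes it a valid smoothness constant of \<open>h\<close>.\<close>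
  define l where "l = 1 / \<alpha> - \<mu>"
  have l: "0 < l" "2 * L - \<mu> \<le> l" using \<alpha> \<alpha>\<mu> by (auto simp: l_def field_simps)
  define H where "H v = G v - \<mu> *\<^sub>R v" for v
  define h where "h v = F v - \<mu> / 2 * (v \<bullet> v)" for v
  define d where "d = z - w"
  define q where "q = H z - H w"
  have quad: "\<mu> / 2 * (norm (b - a))\<^sup>2 = \<mu> / 2 * (b \<bullet> b) - \<mu> / 2 * (a \<bullet> a) - \<mu> * (a \<bullet> (b - a))" for a b :: 'a
    by (simp add: power2_norm_eq_inner algebra_simps inner_commute)
  have H_inner: "H a \<bullet> v = G a \<bullet> v - \<mu> * (a \<bullet> v)" for a v by (simp add: H_def inner_diff_left)
  have h_lower: "h b \<ge> h a + H a \<bullet> (b - a)" for a b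
    using conv[of a b] quad[of b a] unfolding h_def H_inner by linarith
  have h_upper: "h b \<le> h a + H a \<bullet> (b - a) + l / 2 * (norm (b - a))\<^sup>2" for a b
  proof -
    have "(L - \<mu> / 2) * (norm (b - a))\<^sup>2 \<le> l / 2 * (norm (b - a))\<^sup>2"
      using l by (intro mult_right_mono) auto
    then show ?thesis
      using smooth_upper_bound[OF conv lip \<mu>, of b a] quad[of b a] unfolding h_def H_inner left_diff_distrib by linarith
  qed
  define p where "p = z - (1 / l) *\<^sub>R q"
  have "h w + H w \<bullet> (p - w) \<le> h p" by (rule h_lower)
  moreover have "h p \<le> h z + H z \<bullet> (p - z) + l / 2 * (norm (p - z))\<^sup>2" by (rule h_upper)
  moreover have "h z + H z \<bullet> (w - z) \<le> h w" by (rule h_lower)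
  moreover have "H w \<bullet> (p - w) = H w \<bullet> d - (H w \<bullet> q) / l"
    by (simp add: p_def d_def inner_diff_right)
  moreover have "H z \<bullet> (p - z) = - (H z \<bullet> q) / l" by (simp add: p_def)
  moreover have "H z \<bullet> (w - z) = - (H z \<bullet> d)" by (simp add: d_def inner_diff_right)
  moreover have "l / 2 * (norm (p - z))\<^sup>2 = (q \<bullet> q) / l / 2"
  proof -
    have "(norm (p - z))\<^sup>2 = (q \<bullet> q) / l\<^sup>2"
      by (simp add: p_def power_divide power2_norm_eq_inner[of q])
    then show ?thesis using l by (simp add: power2_eq_square[of l])
  qed
  moreover have "(q \<bullet> q) / l = (H z \<bullet> q) / l - (H w \<bullet> q) / l"
    by (simp add: q_def inner_diff_left diff_divide_distrib)
  moreover have "q \<bullet> d = H z \<bullet> d - H w \<bullet> d" by (simp add: q_def inner_diff_left)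
  ultimately have "(q \<bullet> q) / l / 2 \<le> q \<bullet> d" by linarith
  then have coco: "q \<bullet> q \<le> 2 * l * (q \<bullet> d)" using l by (simp add: field_simps)
  have \<alpha>l: "\<alpha> * l = 1 - \<alpha> * \<mu>" using \<alpha> by (simp add: l_def algebra_simps)
  have eq: "(z - \<alpha> *\<^sub>R G z) - (w - \<alpha> *\<^sub>R G w) = (1 - \<alpha> * \<mu>) *\<^sub>R d - \<alpha> *\<^sub>R q"
    by (simp add: d_def q_def H_def algebra_simps)
  have "(norm ((z - \<alpha> *\<^sub>R G z) - (w - \<alpha> *\<^sub>R G w)))\<^sup>2
      = (1 - \<alpha> * \<mu>)\<^sup>2 * (d \<bullet> d) - 2 * \<alpha> * (1 - \<alpha> * \<mu>) * (q \<bullet> d) + \<alpha> * \<alpha> * (q \<bullet> q)"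
    unfolding eq power2_norm_eq_inner
    by (simp add: inner_diff_left inner_diff_right inner_commute[of d q] power2_eq_square algebra_simps)
  also have "\<dots> = (1 - \<alpha> * \<mu>)\<^sup>2 * (d \<bullet> d) + \<alpha> * \<alpha> * (q \<bullet> q - 2 * l * (q \<bullet> d))"
    unfolding \<alpha>l[symmetric] by (simp add: algebra_simps)
  also have "\<dots> \<le> (1 - \<alpha> * \<mu>)\<^sup>2 * (d \<bullet> d)"
    using coco \<alpha>(1) by (simp add: mult_nonneg_nonpos)
  also have "\<dots> = ((1 - \<alpha> * \<mu>) * norm (z - w))\<^sup>2"
    by (simp add: power_mult_distrib power2_norm_eq_inner[of "z - w"] d_def)
  finally show ?thesis
    by (rule power2_le_imp_le) (use \<alpha>\<mu> in simp)
qed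

lemma modulus_le_Lipschitz:
  fixes F :: "'a::real_inner \<Rightarrow> real"
  assumes conv: "\<And>x y. F y \<ge> F x + G x \<bullet> (y - x) + \<mu> / 2 * (norm (y - x))\<^sup>2"
  shows "\<mu> * norm (x - y) \<le> norm (G x - G y)"
proof (cases "x = y")
  case False
  have "\<mu> * (norm (x - y))\<^sup>2 \<le> (G x - G y) \<bullet> (x - y)"
    using conv[of x y] conv[of y x] by (simp add: algebra_simps norm_minus_commute)
  also have "\<dots> \<le> norm (G x - G y) * norm (x - y)" by (rule norm_cauchy_schwarz)
  finally show ?thesis using False by (simp add: power2_eq_square)
qed simp

text \<open>
  The zero of the gradient is the Banach fixed point of a gradient step; quadratic
  growth around it makes it the only minimizer.
\<close>

lemma strongly_convex_unique_minimizer: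
  fixes F :: "'a::{real_inner, complete_space} \<Rightarrow> real"
  assumes conv: "\<And>x y. F y \<ge> F x + G x \<bullet> (y - x) + \<mu> / 2 * (norm (y - x))\<^sup>2"
    and lip: "\<And>x y. norm (G x - G y) \<le> L * norm (x - y)"
    and \<mu>: "0 < \<mu>" and L: "\<mu> \<le> L"
  obtains z where "G z = 0" "(THE z. \<forall>y. F z \<le> F y) = z"
proof -
  define \<alpha> where "\<alpha> = 1 / (2 * L)"
  have \<alpha>: "0 < \<alpha>" "2 * \<alpha> * L \<le> 1" "\<alpha> * \<mu> < 1" using \<mu> L by (auto simp: \<alpha>_def)
  have "\<exists>!z. z - \<alpha> *\<^sub>R G z = z"
  proof (rule banach_fix_type)
    show "0 \<le> 1 - \<alpha> * \<mu>" "1 - \<alpha> * \<mu> < 1" using \<alpha> \<mu> by auto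
    show "\<forall>x y. dist (x - \<alpha> *\<^sub>R G x) (y - \<alpha> *\<^sub>R G y) \<le> (1 - \<alpha> * \<mu>) * dist x y"
      unfolding dist_norm using \<mu> \<alpha> by (intro allI gradient_step_contraction[OF conv lip]) auto
  qed
  then obtain z where z: "G z = 0" using \<alpha>(1) by auto
  have growth: "F y \<ge> F z + \<mu> / 2 * (norm (y - z))\<^sup>2" for y using conv[of z y] z by simp
  have "(THE z. \<forall>y. F z \<le> F y) = z"
  proof (rule the_equality)
    show "\<forall>y. F z \<le> F y"
    proof
      fix y
      have "0 \<le> \<mu> / 2 * (norm (y - z))\<^sup>2" using \<mu> by simp
      then show "F z \<le> F y" using growth[of y] by linarith
    qed
    fix u assume "\<forall>y. F u \<le> F y"
    then have "F u \<le> F z" by blast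
    then have "\<mu> / 2 * (norm (u - z))\<^sup>2 \<le> 0" using growth[of u] by linarith
    then show "u = z" using \<mu> by (simp add: mult_le_0_iff)
  qed
  with z that show ?thesis by blast
qed

section \<open>Stacked variables and averaging\<close>

definition const_rows :: "real ^ 'p \<Rightarrow> real ^ 'p ^ 'n" where
  "const_rows v = (\<chi> i. v)"

definition row_mean :: "real ^ 'p ^ 'n \<Rightarrow> real ^ 'p" where
  "row_mean X = (\<Sum>i\<in>UNIV. X $ i) /\<^sub>R real CARD('n)"

text \<open>
  Serves both for the stacked gradient and for scaling each row by the stepsize of its agent.
\<close>

definition rowwise :: "('n \<Rightarrow> real ^ 'p \<Rightarrow> real ^ 'p) \<Rightarrow> real ^ 'p ^ 'n \<Rightarrow> real ^ 'p ^ 'n" where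
  "rowwise g X = (\<chi> i. g i (X $ i))"

definition deviation :: "real ^ 'p ^ 'n \<Rightarrow> real ^ 'p ^ 'n" where
  "deviation X = X - const_rows (row_mean X)"

definition doubly_stochastic :: "real ^ 'n ^ 'n \<Rightarrow> bool" where
  "doubly_stochastic W \<longleftrightarrow> (\<forall>i j. 0 \<le> W $ i $ j) \<and>
     (\<forall>i. (\<Sum>j\<in>UNIV. W $ i $ j) = 1) \<and> (\<forall>j. (\<Sum>i\<in>UNIV. W $ i $ j) = 1)"

lemma stack_eqI: "(\<And>i. X $ i = Y $ i) \<Longrightarrow> X = (Y :: real ^ 'p ^ 'n)"
  by (simp add: vec_eq_iff[of X Y])

lemma norm_stack_squared: "(norm (X :: real ^ 'p ^ 'n))\<^sup>2 = (\<Sum>i\<in>UNIV. (norm (X $ i))\<^sup>2)"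
  unfolding norm_vec_def[of X] L2_set_def by (simp add: sum_nonneg)

lemma norm_stack_mono:
  fixes X Y :: "real ^ 'p ^ 'n"
  assumes "\<And>i. norm (X $ i) \<le> c * norm (Y $ i)" and "0 \<le> c"
  shows "norm X \<le> c * norm Y"
proof (rule power2_le_imp_le)
  have "(norm X)\<^sup>2 \<le> (\<Sum>i\<in>UNIV. (c * norm (Y $ i))\<^sup>2)"
    unfolding norm_stack_squared by (intro sum_mono power_mono assms) auto
  also have "\<dots> = (c * norm Y)\<^sup>2"
    by (simp add: power_mult_distrib norm_stack_squared sum_distrib_left)
  finally show "(norm X)\<^sup>2 \<le> (c * norm Y)\<^sup>2" .
qed (use assms in auto)

lemma norm_const_rows: "norm (const_rows v :: real ^ 'p ^ 'n) = sqrt (real CARD('n)) * norm v"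
  unfolding norm_vec_def[of "const_rows v"] L2_set_def
  by (simp add: const_rows_def real_sqrt_mult)

text \<open>
Cauchy--Schwarz, in the form that compares the average row norm with the Frobenius norm.
\<close>

lemma sum_norm_rows_le:
  fixes X :: "real ^ 'p ^ 'n"
  shows "(\<Sum>i\<in>UNIV. norm (X $ i)) / real CARD('n) \<le> norm X / sqrt (real CARD('n))"
proof -
  have "(\<Sum>i\<in>UNIV. norm (X $ i)) \<le> sqrt (real CARD('n)) * norm X"
  proof (rule power2_le_imp_le)
    show "(\<Sum>i\<in>UNIV. norm (X $ i))\<^sup>2 \<le> (sqrt (real CARD('n)) * norm X)\<^sup>2"
      using sum_squared_le_sum_of_squares[of "\<lambda>i. norm (X $ i)" "UNIV :: 'n set"]
      by (simp add: power_mult_distrib norm_stack_squared mult.commute)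
  qed simp
  moreover have "0 < sqrt (real CARD('n))" "real CARD('n) = sqrt (real CARD('n)) * sqrt (real CARD('n))"
    by simp_all
  ultimately show ?thesis by (metis mult_left_le_imp_le mult_divide_mult_cancel_left_if divide_right_mono less_imp_le less_irrefl zero_le_mult_iff)
qed

lemma norm_row_mean_le_sum: "norm (row_mean (X :: real ^ 'p ^ 'n)) \<le> (\<Sum>i\<in>UNIV. norm (X $ i)) / real CARD('n)"
  unfolding row_mean_def using norm_sum[of "\<lambda>i. X $ i" UNIV] by (simp add: divide_inverse mult.commute mult_left_mono)

lemma norm_row_mean_le: "norm (row_mean (X :: real ^ 'p ^ 'n)) \<le> norm X / sqrt (real CARD('n))"
  using norm_row_mean_le_sum sum_norm_rows_le by (rule order_trans)

lemma row_mean_linear: "linear (row_mean :: real ^ 'p ^ 'n \<Rightarrow> _)"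
  by (rule linearI) (simp_all add: row_mean_def sum.distrib scaleR_add_right scaleR_sum_right mult.commute)

lemmas row_mean_add = linear_add[OF row_mean_linear]
lemmas row_mean_diff = linear_diff[OF row_mean_linear]

lemma row_mean_const_rows [simp]: "row_mean (const_rows v :: real ^ 'p ^ 'n) = v"
  by (simp add: row_mean_def const_rows_def sum_constant_scaleR del: sum_constant)

lemma const_rows_add: "const_rows (u + v) = const_rows u + const_rows v"
  and const_rows_diff: "const_rows (u - v) = const_rows u - const_rows v"
  by (auto simp: const_rows_def vec_eq_iff)

lemma const_rows_0 [simp]: "const_rows 0 = 0"
  by (simp add: const_rows_def vec_eq_iff)

text \<open>
  Subtracting the mean from each row is an orthogonal projection: the squared norm drops by
  \<open>n\<close> times the squared norm of the mean.
\<close>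

lemma norm_deviation_le: "norm (deviation X) \<le> norm (X :: real ^ 'p ^ 'n)"
proof (rule power2_le_imp_le)
  let ?n = "real CARD('n)"
  have s: "(\<Sum>i\<in>UNIV. X $ i) = ?n *\<^sub>R row_mean X" by (simp add: row_mean_def)
  have "(norm (deviation X))\<^sup>2 = (\<Sum>i\<in>UNIV. (norm (X $ i))\<^sup>2 - 2 * (X $ i \<bullet> row_mean X) + (norm (row_mean X))\<^sup>2)"
    unfolding norm_stack_squared
    by (intro sum.cong) (auto simp: deviation_def const_rows_def power2_norm_eq_inner algebra_simps inner_commute)
  also have "\<dots> = (norm X)\<^sup>2 - 2 * ((\<Sum>i\<in>UNIV. X $ i) \<bullet> row_mean X) + ?n * (norm (row_mean X))\<^sup>2"
    by (simp add: sum.distrib sum_subtractf norm_stack_squared inner_sum_left sum_distrib_left)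
  also have "\<dots> = (norm X)\<^sup>2 - ?n * (norm (row_mean X))\<^sup>2"
    unfolding s by (simp add: power2_norm_eq_inner)
  also have "\<dots> \<le> (norm X)\<^sup>2" by simp
  finally show "(norm (deviation X))\<^sup>2 \<le> (norm X)\<^sup>2" .
qed simp

lemma matrix_mult_row:
  fixes A :: "real ^ 'n ^ 'm" and X :: "real ^ 'p ^ 'n"
  shows "(A ** X) $ i = (\<Sum>j\<in>UNIV. A $ i $ j *\<^sub>R X $ j)"
  by (simp add: matrix_matrix_mult_def vec_eq_iff)

lemma matrix_mult_diff_right:
  fixes A :: "real ^ 'n ^ 'm" and X Y :: "real ^ 'p ^ 'n"
  shows "A ** (X - Y) = A ** X - A ** Y"
  by (intro stack_eqI) (simp add: matrix_mult_row scaleR_diff_right sum_subtractf)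

lemma matrix_mult_diff_left:
  fixes A B :: "real ^ 'n ^ 'm" and X :: "real ^ 'p ^ 'n"
  shows "(A - B) ** X = A ** X - B ** X"
  by (intro stack_eqI) (simp add: matrix_mult_row scaleR_left_diff_distrib sum_subtractf)

text \<open>
  The spectral norm is defined by the action on vectors; it bounds the Frobenius norm of a product
  because multiplication from the left acts on each column separately.
\<close>

lemma norm_matrix_mult_le:
  fixes A :: "real ^ 'n ^ 'n" and X :: "real ^ 'p ^ 'n"
  shows "norm (A ** X) \<le> spectral_norm A * norm X"
proof (rule power2_le_imp_le)
  have cols: "(norm Y)\<^sup>2 = (\<Sum>c\<in>UNIV. (norm (Finite_Cartesian_Product.column c Y))\<^sup>2)" for Y :: "real ^ 'p ^ 'n"
    unfolding norm_stack_squared power2_norm_eq_inner inner_vec_def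
    by (subst sum.swap) (simp add: Finite_Cartesian_Product.column_def)
  have col: "Finite_Cartesian_Product.column c (A ** X) = A *v Finite_Cartesian_Product.column c X" for c
    by (simp add: Finite_Cartesian_Product.column_def matrix_matrix_mult_def matrix_vector_mult_def)
  have "(norm (A ** X))\<^sup>2 \<le> (\<Sum>c\<in>UNIV. (spectral_norm A * norm (Finite_Cartesian_Product.column c X))\<^sup>2)"
    unfolding cols[of "A ** X"] col spectral_norm_def by (intro sum_mono power_mono onorm) auto
  also have "\<dots> = (spectral_norm A * norm X)\<^sup>2"
    by (simp add: power_mult_distrib cols sum_distrib_left)
  finally show "(norm (A ** X))\<^sup>2 \<le> (spectral_norm A * norm X)\<^sup>2" .
  show "0 \<le> spectral_norm A * norm X"
    by (simp add: spectral_norm_def onorm_pos_le)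
qed

lemma spectral_norm_nonneg: "0 \<le> spectral_norm A"
  by (simp add: spectral_norm_def onorm_pos_le)

context
  fixes W :: "real ^ 'n ^ 'n"
  assumes ds: "doubly_stochastic W"
begin

text \<open>
  Each new row is a convex combination of the old ones, so Jensen's inequality bounds its squared
  norm; unit column sums then make the total at most the old total.
\<close>

lemma norm_averaging_le: "norm (W ** X) \<le> norm (X :: real ^ 'p ^ 'n)"
proof (rule power2_le_imp_le)
  have "(norm ((W ** X) $ i))\<^sup>2 \<le> (\<Sum>j\<in>UNIV. W $ i $ j * (norm (X $ j))\<^sup>2)" for i
  proof -
    have "norm ((W ** X) $ i) \<le> (\<Sum>j\<in>UNIV. W $ i $ j * norm (X $ j))"
      unfolding matrix_mult_row using ds
      by (intro sum_norm_le) (simp add: doubly_stochastic_def)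
    then have "(norm ((W ** X) $ i))\<^sup>2 \<le> (\<Sum>j\<in>UNIV. W $ i $ j * norm (X $ j))\<^sup>2"
      by (intro power_mono) auto
    also have "\<dots> \<le> (\<Sum>j\<in>UNIV. W $ i $ j * (norm (X $ j))\<^sup>2)"
      using convex_on_sum[OF _ _ convex_power2, of UNIV "\<lambda>j. W $ i $ j" "\<lambda>j. norm (X $ j)"] ds
      by (simp add: doubly_stochastic_def)
    finally show ?thesis .
  qed
  then have "(norm (W ** X))\<^sup>2 \<le> (\<Sum>i\<in>UNIV. \<Sum>j\<in>UNIV. W $ i $ j * (norm (X $ j))\<^sup>2)"
    unfolding norm_stack_squared[of "W ** X"] by (intro sum_mono) auto
  also have "\<dots> = (\<Sum>j\<in>UNIV. (\<Sum>i\<in>UNIV. W $ i $ j) * (norm (X $ j))\<^sup>2)"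
    by (subst sum.swap) (simp add: sum_distrib_right)
  also have "\<dots> = (norm X)\<^sup>2" using ds by (simp add: doubly_stochastic_def norm_stack_squared)
  finally show "(norm (W ** X))\<^sup>2 \<le> (norm X)\<^sup>2" .
qed simp

lemma averaging_const_rows: "W ** const_rows v = (const_rows v :: real ^ 'p ^ 'n)"
  using ds by (intro stack_eqI) (simp add: matrix_mult_row const_rows_def doubly_stochastic_def
      flip: scaleR_sum_left)

lemma row_mean_averaging: "row_mean (W ** X) = row_mean (X :: real ^ 'p ^ 'n)"
proof -
  have "(\<Sum>i\<in>UNIV. (W ** X) $ i) = (\<Sum>j\<in>UNIV. (\<Sum>i\<in>UNIV. W $ i $ j) *\<^sub>R X $ j)"
    unfolding matrix_mult_row by (subst sum.swap) (simp add: scaleR_sum_left)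
  then show ?thesis using ds by (simp add: row_mean_def doubly_stochastic_def)
qed

text \<open>
Connects the deviation with the matrix whose spectral norm defines the mixing rate.
\<close>

lemma deviation_averaging:
  "deviation (W ** X) = (W - (\<chi> i j. 1 / real CARD('n))) ** (X :: real ^ 'p ^ 'n)"
  unfolding deviation_def row_mean_averaging
  by (intro stack_eqI) (simp add: const_rows_def row_mean_def
      matrix_mult_row scaleR_left_diff_distrib sum_subtractf scaleR_sum_right divide_inverse)

lemma norm_deviation_averaging_le:
  "norm (deviation (W ** X)) \<le> mixing_rate W * norm (X :: real ^ 'p ^ 'n)"
  unfolding deviation_averaging mixing_rate_def by (rule norm_matrix_mult_le)

text \<open>
  Sharpens the previous bound: averaging leaves constant rows alone, so \<open>X\<close> may be replaced by
  its deviation.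
\<close>

lemma norm_deviation_averaging_contracts:
  "norm (deviation (W ** X)) \<le> mixing_rate W * norm (deviation (X :: real ^ 'p ^ 'n))"
proof -
  have "deviation (W ** deviation X) = deviation (W ** X)"
    unfolding deviation_def[of "W ** _"] row_mean_averaging
    by (simp add: deviation_def matrix_mult_diff_right averaging_const_rows row_mean_diff const_rows_diff)
  then show ?thesis using norm_deviation_averaging_le[of "deviation X"] by simp
qed

end

section \<open>Contraction of the three errors\<close>

lemma rowwise_Lipschitz:
  fixes X Z :: "real ^ 'p ^ 'n"
  assumes lip: "\<And>i u v. norm (g i u - g i v) \<le> L * norm (u - v)" and L: "0 \<le> L"
  shows "norm (rowwise g X - rowwise g Z) \<le> L * norm (X - Z)"
  using lip L by (intro norm_stack_mono) (auto simp: rowwise_def)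

text \<open>
  Splits the distance from a common value into the consensus error and the error of the mean; it
  serves for the iterates (with the minimizer) and for the trackers (with 0).
\<close>

lemma norm_deviation_split:
  fixes X :: "real ^ 'p ^ 'n"
  shows "norm (X - const_rows z) \<le> norm (deviation X) + sqrt (real CARD('n)) * norm (row_mean X - z)"
proof -
  have "X - const_rows z = deviation X + const_rows (row_mean X - z)"
    by (simp add: deviation_def const_rows_diff)
  then show ?thesis using norm_triangle_ineq[of "deviation X" "const_rows (row_mean X - z)"]
    by (simp add: norm_const_rows)
qed

lemma average_strongly_convex:
  fixes f :: "'n::finite \<Rightarrow> real ^ 'p \<Rightarrow> real"
  assumes conv: "\<And>i x y. f i y \<ge> f i x + g i x \<bullet> (y - x) + \<mu> / 2 * (norm (y - x))\<^sup>2"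
  shows "(\<Sum>i\<in>UNIV. f i y) / real CARD('n) \<ge> (\<Sum>i\<in>UNIV. f i x) / real CARD('n)
     + row_mean (rowwise g (const_rows x)) \<bullet> (y - x) + \<mu> / 2 * (norm (y - x))\<^sup>2"
proof -
  let ?n = "real CARD('n)"
  have "(\<Sum>i\<in>UNIV. f i x + g i x \<bullet> (y - x) + \<mu> / 2 * (norm (y - x))\<^sup>2) \<le> (\<Sum>i\<in>UNIV. f i y)"
    by (intro sum_mono conv)
  then have "((\<Sum>i\<in>UNIV. f i x) + (\<Sum>i\<in>UNIV. g i x) \<bullet> (y - x) + ?n * (\<mu> / 2 * (norm (y - x))\<^sup>2)) / ?n
      \<le> (\<Sum>i\<in>UNIV. f i y) / ?n"
    by (intro divide_right_mono) (simp_all add: sum.distrib inner_sum_left)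
  moreover have "row_mean (rowwise g (const_rows x)) \<bullet> (y - x) = ((\<Sum>i\<in>UNIV. g i x) \<bullet> (y - x)) / ?n"
    by (simp add: row_mean_def rowwise_def const_rows_def divide_inverse mult.commute)
  ultimately show ?thesis by (simp add: add_divide_distrib)
qed

lemma average_Lipschitz:
  fixes g :: "'n::finite \<Rightarrow> real ^ 'p \<Rightarrow> real ^ 'p"
  assumes lip: "\<And>i u v. norm (g i u - g i v) \<le> L * norm (u - v)" and L: "0 \<le> L"
  shows "norm (row_mean (rowwise g X) - row_mean (rowwise g Z)) \<le> L * norm (X - Z) / sqrt (real CARD('n))"
proof -
  have "norm (row_mean (rowwise g X - rowwise g Z)) \<le> norm (rowwise g X - rowwise g Z) / sqrt (real CARD('n))"
    by (rule norm_row_mean_le)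
  also have "\<dots> \<le> L * norm (X - Z) / sqrt (real CARD('n))"
    by (intro divide_right_mono rowwise_Lipschitz[OF lip L]) auto
  finally show ?thesis by (simp add: row_mean_diff)
qed

lemma average_Lipschitz_const:
  fixes g :: "'n::finite \<Rightarrow> real ^ 'p \<Rightarrow> real ^ 'p"
  assumes lip: "\<And>i u v. norm (g i u - g i v) \<le> L * norm (u - v)" and L: "0 \<le> L"
  shows "norm (row_mean (rowwise g (const_rows u)) - row_mean (rowwise g (const_rows v))) \<le> L * norm (u - v)"
  using average_Lipschitz[where g = g and X = "const_rows u :: real ^ 'p ^ 'n" and Z = "const_rows v", OF lip L]
  by (simp add: norm_const_rows flip: const_rows_diff)

text \<open>
  One iteration in terms of the three errors; the coefficients are the entries of the matrix of the
  theorem.  In the two consensus estimates the scaled trackers enter through the norm of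
  \<open>Y\<close>: its deviation is one of the errors, and its mean is the mean gradient, which vanishes
  at the minimizer and is therefore controlled by the distance of \<open>X\<close> from it.  In the third
  estimate the mean gradient must not be bounded by its norm, because it provides the contraction.
\<close>

lemma gradient_tracking_step:
  fixes W :: "real ^ 'n ^ 'n" and X Y X' Y' :: "real ^ 'p ^ 'n"
    and f :: "'n \<Rightarrow> real ^ 'p \<Rightarrow> real" and s :: "'n \<Rightarrow> real"
  defines "n \<equiv> real CARD('n)"
  assumes ds: "doubly_stochastic W"
    and conv: "\<And>i x y. f i y \<ge> f i x + g i x \<bullet> (y - x) + \<mu> / 2 * (norm (y - x))\<^sup>2"
    and lip: "\<And>i u v. norm (g i u - g i v) \<le> L * norm (u - v)"
    and \<mu>: "0 < \<mu>" "\<mu> \<le> L"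
    and z: "row_mean (rowwise g (const_rows z)) = 0"
    and s: "\<And>i. lo \<le> s i" "\<And>i. s i \<le> a" and lo: "0 < lo" and a: "2 * a * L \<le> 1"
    and tracking: "row_mean Y = row_mean (rowwise g X)"
    and X': "X' = W ** (X - rowwise (\<lambda>i v. s i *\<^sub>R v) Y)"
    and Y': "Y' = W ** Y + rowwise g X' - rowwise g X"
  shows "norm (deviation X') \<le> (mixing_rate W + mixing_rate W * a * L) * norm (deviation X)
           + mixing_rate W * a * norm (deviation Y)
           + sqrt n * mixing_rate W * a * L * norm (row_mean X - z)" (is ?consensus)
    and "norm (deviation Y') \<le> L * (spectral_norm (W - Finite_Cartesian_Product.mat 1) + L * a) * norm (deviation X)
           + (mixing_rate W + L * a) * norm (deviation Y)
           + sqrt n * L\<^sup>2 * a * norm (row_mean X - z)" (is ?tracking)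
    and "norm (row_mean X' - z) \<le> L * a / sqrt n * norm (deviation X)
           + a / sqrt n * norm (deviation Y) + (1 - \<mu> * lo) * norm (row_mean X - z)" (is ?optimality)
proof -
  define lam where "lam = mixing_rate W"
  define d where "d = spectral_norm (W - Finite_Cartesian_Product.mat 1)"
  have lam: "0 \<le> lam" and d: "0 \<le> d" by (simp_all add: lam_def d_def mixing_rate_def spectral_norm_nonneg)
  have L: "0 \<le> L" using \<mu> by linarith
  have n: "0 < n" by (simp add: n_def)
  have a0: "0 \<le> a" using s[of undefined] lo by linarith
  define scaled where "scaled = (rowwise (\<lambda>i v. s i *\<^sub>R v) :: real ^ 'p ^ 'n \<Rightarrow> real ^ 'p ^ 'n)"
  have norm_scaled: "norm (scaled Z) \<le> a * norm Z" for Z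
  proof (rule norm_stack_mono)
    fix i
    have "\<bar>s i\<bar> \<le> a" using s(1)[of i] s(2)[of i] lo by linarith
    then show "norm (scaled Z $ i) \<le> a * norm (Z $ i)"
      by (simp add: scaled_def rowwise_def mult_right_mono)
  qed (rule a0)
  define e1 e2 e3 where "e1 = norm (deviation X)" and "e2 = norm (deviation Y)" and "e3 = norm (row_mean X - z)"
  have norm_Y: "norm Y \<le> e2 + L * (e1 + sqrt n * e3)"
  proof -
    have "norm (row_mean Y) \<le> L * norm (X - const_rows z) / sqrt n"
      using average_Lipschitz[where g = g and X = X and Z = "const_rows z", OF lip L] by (simp add: z tracking n_def)
    then have "sqrt n * norm (row_mean Y) \<le> sqrt n * (L * norm (X - const_rows z) / sqrt n)"
      using n by (intro mult_left_mono) auto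
    also have "\<dots> = L * norm (X - const_rows z)" using n by simp
    also have "\<dots> \<le> L * (e1 + sqrt n * e3)"
      unfolding e1_def e3_def n_def using L by (intro mult_left_mono norm_deviation_split)
    finally have "sqrt n * norm (row_mean Y) \<le> L * (e1 + sqrt n * e3)" .
    then show ?thesis using norm_deviation_split[of Y 0] 
      by (simp add: e2_def n_def)
  qed
  then have norm_sY: "norm (scaled Y) \<le> a * (e2 + L * (e1 + sqrt n * e3))"
    using norm_scaled[of Y] a0 by (meson mult_left_mono order_trans)
  show ?consensus
  proof -
    have "X' = W ** X - W ** scaled Y" by (simp add: X' scaled_def matrix_mult_diff_right)
    then have "deviation X' = deviation (W ** X) - deviation (W ** scaled Y)"
      by (simp add: deviation_def row_mean_diff const_rows_diff)
    then have "norm (deviation X') \<le> norm (deviation (W ** X)) + norm (deviation (W ** scaled Y))"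
      by (simp add: norm_triangle_ineq4)
    also have "\<dots> \<le> lam * e1 + lam * (a * (e2 + L * (e1 + sqrt n * e3)))"
      unfolding e1_def lam_def[symmetric]
      using norm_deviation_averaging_contracts[OF ds, of X] 
        order_trans[OF norm_deviation_averaging_le[OF ds, of "scaled Y"] mult_left_mono[OF norm_sY]] lam
      unfolding e1_def lam_def by (intro add_mono) auto
    finally show ?thesis unfolding e1_def[symmetric] e2_def[symmetric] e3_def[symmetric] lam_def[symmetric]
      by (simp add: algebra_simps)
  qed
  show ?tracking
  proof -
    \<comment> \<open>Averaging fixes constant rows, so \<open>W - I\<close> sees only the deviation of \<open>X\<close>.\<close>
    have "X' - X = (W - Finite_Cartesian_Product.mat 1) ** deviation X - W ** scaled Y"
      by (simp add: X' scaled_def matrix_mult_diff_right matrix_mult_diff_left deviation_def averaging_const_rows[OF ds])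
    then have "norm (X' - X) \<le> norm ((W - Finite_Cartesian_Product.mat 1) ** deviation X) + norm (W ** scaled Y)"
      by (simp add: norm_triangle_ineq4)
    also have "\<dots> \<le> d * e1 + a * (e2 + L * (e1 + sqrt n * e3))"
      unfolding d_def e1_def
      using order_trans[OF norm_averaging_le[OF ds] norm_sY] 
      by (intro add_mono norm_matrix_mult_le) (simp add: e1_def)
    finally have move: "norm (X' - X) \<le> d * e1 + a * (e2 + L * (e1 + sqrt n * e3))" .
    have "deviation Y' = deviation (W ** Y) + deviation (rowwise g X' - rowwise g X)"
      by (simp add: Y' deviation_def row_mean_add row_mean_diff const_rows_add const_rows_diff)
    then have "norm (deviation Y') \<le> norm (deviation (W ** Y)) + norm (deviation (rowwise g X' - rowwise g X))"
      by (simp add: norm_triangle_ineq)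
    also have "\<dots> \<le> lam * e2 + L * (d * e1 + a * (e2 + L * (e1 + sqrt n * e3)))"
    proof (rule add_mono)
      show "norm (deviation (W ** Y)) \<le> lam * e2"
        unfolding lam_def e2_def by (rule norm_deviation_averaging_contracts[OF ds])
      have "norm (deviation (rowwise g X' - rowwise g X)) \<le> L * norm (X' - X)"
        using norm_deviation_le rowwise_Lipschitz[OF lip L] by (rule order_trans)
      also have "\<dots> \<le> L * (d * e1 + a * (e2 + L * (e1 + sqrt n * e3)))"
        using move L by (rule mult_left_mono)
      finally show "norm (deviation (rowwise g X' - rowwise g X)) \<le> L * (d * e1 + a * (e2 + L * (e1 + sqrt n * e3)))" .
    qed
    finally show ?thesis unfolding e1_def[symmetric] e2_def[symmetric] e3_def[symmetric] lam_def[symmetric] d_def[symmetric]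
      by (simp add: algebra_simps power2_eq_square)
  qed
  show ?optimality
  proof -
    define G where "G u = row_mean (rowwise g (const_rows u :: real ^ 'p ^ 'n))" for u
    define m where "m = (\<Sum>i\<in>UNIV. s i) / n"
    have "lo \<le> m"
      using sum_mono[of UNIV "\<lambda>_. lo" s] s(1) n by (simp add: m_def n_def field_simps)
    moreover have "m \<le> a"
      using sum_mono[of UNIV s "\<lambda>_. a"] s(2) n by (simp add: m_def n_def field_simps)
    ultimately have m: "lo \<le> m" "m \<le> a" "0 < m" "2 * m * L \<le> 1" "m * \<mu> < 1"
    proof -
      assume *: "lo \<le> m" "m \<le> a"
      show "0 < m" using * lo by simp
      have "m * L \<le> a * L" using * L by (intro mult_right_mono) auto
      then show "2 * m * L \<le> 1" using a by simp
      moreover have "m * \<mu> \<le> m * L" using * lo \<mu> by (intro mult_left_mono) auto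
      ultimately show "m * \<mu> < 1" by simp
    qed auto
    \<comment> \<open>The stepsizes differ between agents: only the common part of the trackers moves the mean with the mean stepsize \<open>m\<close>.\<close>
    have split: "row_mean (scaled Y) = row_mean (scaled (deviation Y)) + m *\<^sub>R row_mean Y"
    proof -
      have "scaled Y = scaled (deviation Y) + scaled (const_rows (row_mean Y))"
        by (simp add: scaled_def rowwise_def deviation_def vec_eq_iff algebra_simps)
      moreover have "row_mean (scaled (const_rows u)) = m *\<^sub>R u" for u
        by (simp add: row_mean_def scaled_def rowwise_def const_rows_def m_def n_def
            divide_inverse mult.commute flip: scaleR_sum_left)
      ultimately show ?thesis by (simp add: row_mean_add)
    qed
    have triangle: "norm (u - v - w) \<le> norm u + norm v + norm w" for u v w :: "real ^ 'p"
      using norm_triangle_ineq4[of "u - v" w] norm_triangle_ineq4[of u v] by linarith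
    have "row_mean X' = row_mean X - row_mean (scaled Y)"
      by (simp add: X' row_mean_averaging[OF ds] row_mean_diff scaled_def)
    then have "row_mean X' - z = ((row_mean X - m *\<^sub>R G (row_mean X)) - (z - m *\<^sub>R G z))
        - m *\<^sub>R (row_mean (rowwise g X) - G (row_mean X)) - row_mean (scaled (deviation Y))"
      by (simp add: split tracking G_def z algebra_simps)
    then have "norm (row_mean X' - z) \<le> norm ((row_mean X - m *\<^sub>R G (row_mean X)) - (z - m *\<^sub>R G z))
        + norm (m *\<^sub>R (row_mean (rowwise g X) - G (row_mean X))) + norm (row_mean (scaled (deviation Y)))"
      by (simp only: triangle)
    also have "\<dots> \<le> (1 - \<mu> * lo) * e3 + a * (L * e1 / sqrt n) + a * e2 / sqrt n"
    proof (intro add_mono)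
      have "norm ((row_mean X - m *\<^sub>R G (row_mean X)) - (z - m *\<^sub>R G z)) \<le> (1 - m * \<mu>) * e3"
        unfolding e3_def using \<mu> m unfolding G_def
        by (intro gradient_step_contraction[OF average_strongly_convex[of f g \<mu>, OF conv]
              average_Lipschitz_const[OF lip L]]) auto
      also have "\<dots> \<le> (1 - \<mu> * lo) * e3"
        using m \<mu> by (intro mult_right_mono) (auto simp: e3_def mult.commute)
      finally show "norm ((row_mean X - m *\<^sub>R G (row_mean X)) - (z - m *\<^sub>R G z)) \<le> (1 - \<mu> * lo) * e3" .
      have "norm (row_mean (rowwise g X) - G (row_mean X)) \<le> L * e1 / sqrt n"
        unfolding G_def e1_def n_def deviation_def by (rule average_Lipschitz[OF lip L])
      then have "m * norm (row_mean (rowwise g X) - G (row_mean X)) \<le> a * (L * e1 / sqrt n)"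
        using m a0 by (intro mult_mono) auto
      then show "norm (m *\<^sub>R (row_mean (rowwise g X) - G (row_mean X))) \<le> a * (L * e1 / sqrt n)"
        using m by simp
      show "norm (row_mean (scaled (deviation Y))) \<le> a * e2 / sqrt n"
        using order_trans[OF norm_row_mean_le divide_right_mono[OF norm_scaled]] n
        by (simp add: n_def e2_def)
    qed
    finally show ?thesis unfolding e1_def[symmetric] e2_def[symmetric] e3_def[symmetric]
      by (simp add: algebra_simps)
  qed
qed

lemma AdGT_matrix_entries:
  fixes W :: "real ^ 'n ^ 'n"
  shows "AdGT_matrix W L \<mu> lo a \<in> carrier_mat 3 3"
    and "AdGT_matrix W L \<mu> lo a $$ (0, 0) = mixing_rate W + mixing_rate W * a * L"
    and "AdGT_matrix W L \<mu> lo a $$ (0, 1) = mixing_rate W * a"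
    and "AdGT_matrix W L \<mu> lo a $$ (0, 2) = sqrt (real CARD('n)) * mixing_rate W * a * L"
    and "AdGT_matrix W L \<mu> lo a $$ (1, 0) = L * (spectral_norm (W - Finite_Cartesian_Product.mat 1) + L * a)"
    and "AdGT_matrix W L \<mu> lo a $$ (1, 1) = mixing_rate W + L * a"
    and "AdGT_matrix W L \<mu> lo a $$ (1, 2) = sqrt (real CARD('n)) * L\<^sup>2 * a"
    and "AdGT_matrix W L \<mu> lo a $$ (2, 0) = L * a / sqrt (real CARD('n))"
    and "AdGT_matrix W L \<mu> lo a $$ (2, 1) = a / sqrt (real CARD('n))"
    and "AdGT_matrix W L \<mu> lo a $$ (2, 2) = 1 - \<mu> * lo"
  by (simp_all add: AdGT_matrix_def mat_of_rows_list_def Let_def numeral_3_eq_3)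

text \<open>
  The stepsize bounds are assumed from index 1 on, so the comparison starts with the errors at
  iteration 1; this accounts for the exponent \<open>k - 1\<close> in the rate.
\<close>

lemma gradient_tracking_linear_convergence:
  fixes W :: "real ^ 'n ^ 'n" and x y :: "nat \<Rightarrow> real ^ 'p ^ 'n"
    and f :: "'n \<Rightarrow> real ^ 'p \<Rightarrow> real" and \<alpha> :: "nat \<Rightarrow> 'n \<Rightarrow> real"
  assumes ds: "doubly_stochastic W"
    and conv: "\<And>i x y. f i y \<ge> f i x + g i x \<bullet> (y - x) + \<mu> / 2 * (norm (y - x))\<^sup>2"
    and lip: "\<And>i u v. norm (g i u - g i v) \<le> L * norm (u - v)"
    and \<mu>: "0 < \<mu>" "\<mu> \<le> L"
    and \<alpha>: "\<And>k i. lo \<le> \<alpha> (Suc k) i" "\<And>k i. \<alpha> (Suc k) i \<le> a" and lo: "0 < lo" and a: "2 * a * L \<le> 1"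
    and y0: "y 0 = rowwise g (x 0)"
    and x_step: "\<And>k. x (Suc k) = W ** (x k - rowwise (\<lambda>i v. \<alpha> k i *\<^sub>R v) (y k))"
    and y_step: "\<And>k. y (Suc k) = W ** y k + rowwise g (x (Suc k)) - rowwise g (x k)"
  shows "converges_linearly_near x (const_rows (avg_minimizer f))
           (real_spectral_radius (AdGT_matrix W L \<mu> lo a))"
proof -
  obtain z where z: "row_mean (rowwise g (const_rows z :: real ^ 'p ^ 'n)) = 0" and "avg_minimizer f = z"
    using strongly_convex_unique_minimizer[OF average_strongly_convex[of f g \<mu>, OF conv]
        average_Lipschitz_const[OF lip] \<mu>] \<mu> unfolding avg_minimizer_def by auto
  \<comment> \<open>Invariant of gradient tracking, preserved because averaging does not change the mean.\<close>
  have tracking: "row_mean (y k) = row_mean (rowwise g (x k))" for k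
    by (induction k) (simp_all add: y0 y_step row_mean_averaging[OF ds] row_mean_add row_mean_diff)
  define A where "A = AdGT_matrix W L \<mu> lo a"
  note entries = AdGT_matrix_entries[of W L \<mu> lo a, folded A_def]
  have A: "A \<in> carrier_mat 3 3" by (rule entries)
  define n where "n = sqrt (real CARD('n))"
  have n: "0 < n" by (simp add: n_def)
  have a0: "0 \<le> a" using \<alpha>[of 0 undefined] lo by linarith
  have "\<mu> * lo \<le> L * a" using \<mu> lo \<alpha>[of 0 undefined] by (intro mult_mono) auto
  then have diag: "0 \<le> 1 - \<mu> * lo" using a by (simp add: mult.commute)
  have nonneg: "0 \<le> A $$ (i, j)" if "i < 3" "j < 3" for i j
  proof -
    have "i = 0 \<or> i = 1 \<or> i = 2" "j = 0 \<or> j = 1 \<or> j = 2" using that by auto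
    then show ?thesis
      using a0 \<mu> diag spectral_norm_nonneg[of "W - (\<chi> i j. 1 / real CARD('n))"]
        spectral_norm_nonneg[of "W - Finite_Cartesian_Product.mat 1"]
      by (elim disjE) (simp_all only: entries, auto simp: mixing_rate_def)
  qed
  define v where "v k i = (if i = 0 then norm (deviation (x (Suc k))) else if i = (1::nat) then norm (deviation (y (Suc k)))
      else norm (row_mean (x (Suc k)) - z))" for k i
  have three: "(\<Sum>j<3. h j) = h 0 + h 1 + h (2::nat)" for h :: "nat \<Rightarrow> real"
    by (simp add: eval_nat_numeral)
  have step: "v (Suc k) i \<le> (\<Sum>j<3. A $$ (i, j) * v k j)" if "i < 3" for k i
  proof -
    note ineqs = gradient_tracking_step[where g = g and f = f, OF ds conv lip \<mu> z \<alpha>(1) \<alpha>(2) lo a tracking x_step y_step]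
    have "i = 0 \<or> i = 1 \<or> i = 2" using that by auto
    then show ?thesis unfolding three
      by (elim disjE) (simp_all only: entries, use ineqs[of k] in \<open>simp_all add: v_def\<close>)
  qed
  show ?thesis unfolding converges_linearly_near_def A_def[symmetric]
  proof (intro allI impI)
    fix \<zeta> assume \<zeta>: "0 < \<zeta> \<and> \<zeta> < 1 - real_spectral_radius A"
    define s where "s = real_spectral_radius A + \<zeta>"
    obtain C where C: "0 \<le> C" "\<And>k i. i < 3 \<Longrightarrow> v k i \<le> C * s ^ k"
      using nonneg_comparison_geometric_bound[where v = v and s = s, OF A _ nonneg step] \<zeta> by (auto simp: s_def)
    show "\<exists>C\<ge>0. \<forall>k\<ge>1. norm (x k - const_rows (avg_minimizer f)) \<le> C * s ^ (k - 1)"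
    proof (intro exI[of _ "C + n * C"] conjI allI impI)
      show "0 \<le> C + n * C" using C n by simp
      fix k :: nat assume "1 \<le> k"
      then obtain m where k: "k = Suc m" by (cases k) auto
      have "norm (x k - const_rows z) \<le> v m 0 + n * v m 2"
        using norm_deviation_split[of "x k" z] by (simp add: v_def k n_def)
      also have "\<dots> \<le> C * s ^ m + n * (C * s ^ m)"
        using C(2) n by (intro add_mono mult_left_mono) auto
      finally show "norm (x k - const_rows (avg_minimizer f)) \<le> (C + n * C) * s ^ (k - 1)"
        by (simp add: k \<open>avg_minimizer f = z\<close> algebra_simps)
    qed
  qed
qed

section \<open>Adaptive stepsizes\<close>

text \<open>
  Common shape of both update rules for one agent: \<open>C k\<close> is the set of curvature candidates,
  \<open>t\<close> the stepsize ratio, and \<open>stay k\<close> says that the agent did not move.  The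
  growth candidate never falls below \<open>a k\<close> because all ratios are nonnegative.
\<close>

lemma stepsize_lower_bound:
  fixes a t :: "nat \<Rightarrow> real"
  assumes step: "\<And>k. a (Suc k) = (if stay k then a k else Min (C k \<union> {sqrt (1 + t k) * a k}))"
    and t: "t 0 = 0" "\<And>k. t (Suc k) = a (Suc k) / a k"
    and fin: "\<And>k. finite (C k)"
    and lo: "\<And>k c. \<not> stay k \<Longrightarrow> c \<in> C k \<Longrightarrow> b \<le> c"
    and b: "0 < b" "b \<le> a 0"
  shows "b \<le> a k"
proof -
  have "b \<le> a k \<and> 0 \<le> t k"
  proof (induction k)
    case 0
    then show ?case using b t by simp
  next
    case (Suc k)
    have "1 * a k \<le> sqrt (1 + t k) * a k" using Suc b by (intro mult_right_mono) auto
    then have "b \<le> sqrt (1 + t k) * a k" using Suc by simp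
    then have "b \<le> a (Suc k)" using Suc lo[of k] fin[of k] by (auto simp: step[of k])
    then show ?case using Suc b(1) by (simp add: t(2))
  qed
  then show ?thesis ..
qed

text \<open>
  An iteration without a move keeps the stepsize, hence also a bound that was established at an
  earlier move; the first iteration is a move by assumption.
\<close>

lemma stepsize_upper_bound:
  fixes a t :: "nat \<Rightarrow> real"
  assumes step: "\<And>k. a (Suc k) = (if stay k then a k else Min (C k \<union> {sqrt (1 + t k) * a k}))"
    and fin: "\<And>k. finite (C k)"
    and first: "\<not> stay 0"
    and up: "\<And>k. \<not> stay k \<Longrightarrow> \<exists>c\<in>C k. c \<le> b"
  shows "a (Suc k) \<le> b"
proof -
  have moved: "a (Suc k) \<le> b" if "\<not> stay k" for k
  proof -
    from up[OF that] obtain c where "c \<in> C k" "c \<le> b" by auto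
    then have "Min (C k \<union> {sqrt (1 + t k) * a k}) \<le> b" using fin[of k]
      by (intro order_trans[OF Min_le]) auto
    then show ?thesis using that by (simp add: step[of k])
  qed
  show ?thesis
  proof (induction k)
    case 0
    show ?case by (rule moved[OF first])
  next
    case (Suc k)
    then show ?case using moved[of "Suc k"] by (cases "stay (Suc k)") (simp_all add: step[of "Suc k"])
  qed
qed

lemma finite_candidate: "finite (candidate \<gamma> l)"
  by (simp add: candidate_def)

lemma candidate_lower_bound:
  assumes "c \<in> candidate \<gamma> l" "0 < \<gamma>" "0 \<le> l" "l \<le> u"
  shows "1 / (2 * \<gamma> * u) \<le> c"
  using assms by (auto simp: candidate_def split: if_splits intro!: divide_left_mono)

lemma candidate_upper_bound:
  assumes "0 < \<gamma>" "0 < m" "m \<le> l"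
  shows "\<exists>c\<in>candidate \<gamma> l. c \<le> 1 / (2 * \<gamma> * m)"
  using assms by (auto simp: candidate_def intro!: divide_left_mono)

lemma mixing_matrix_doubly_stochastic: "mixing_matrix E W \<Longrightarrow> doubly_stochastic W"
  by (auto simp: mixing_matrix_def doubly_stochastic_def)

lemma sum_over_neighbours:
  assumes "mixing_matrix E W"
  shows "(\<Sum>j\<in>nbhd E i. W $ i $ j *\<^sub>R (v j :: 'a::real_vector)) = (\<Sum>j\<in>UNIV. W $ i $ j *\<^sub>R v j)"
  using assms by (intro sum.mono_neutral_left) (auto simp: mixing_matrix_def)

text \<open>
  The iteration in matrix form: weights vanish outside the neighbourhood, so the sums over
  neighbours are rows of a matrix product.
\<close>

lemma AdGT_stacked:
  assumes "AdGT_common E W f x y \<alpha> \<theta>" and W: "mixing_matrix E W"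
  defines "g \<equiv> \<lambda>i. grad (f i)"
  shows "y 0 = rowwise g (x 0)"
    and "x (Suc k) = W ** (x k - rowwise (\<lambda>i v. \<alpha> k i *\<^sub>R v) (y k))"
    and "y (Suc k) = W ** y k + rowwise g (x (Suc k)) - rowwise g (x k)"
  using assms(1) unfolding AdGT_common_def g_def
  by (auto intro!: stack_eqI simp: rowwise_def matrix_mult_row sum_over_neighbours[OF W])

text \<open>
  The tracker increment of agent \<open>i\<close> is the gradient increment plus the disagreement term, so
  the two curvature estimates differ by at most \<open>\<xi>\<close>.
\<close>

lemma estimate_bounds:
  fixes x y :: "nat \<Rightarrow> real ^ 'p ^ 'n" and f :: "'n \<Rightarrow> real ^ 'p \<Rightarrow> real"
  assumes AdGT: "AdGT_common E W f x y \<alpha> \<theta>" and W: "mixing_matrix E W"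
    and smooth: "L_smooth l (f i)" and convex: "strongly_convex m (f i)"
    and disagreement: "norm (\<Sum>j\<in>UNIV. W $ i $ j *\<^sub>R (y k $ j - y k $ i)) \<le> \<xi> * norm (x (Suc k) $ i - x k $ i)"
    and moved: "x (Suc k) $ i \<noteq> x k $ i"
  shows "m \<le> Lf_est f x k i" "Lf_est f x k i \<le> l"
    and "m - \<xi> \<le> Ly_est x y k i" "Ly_est x y k i \<le> l + \<xi>"
proof -
  define h where "h = norm (x (Suc k) $ i - x k $ i)"
  have h: "0 < h" using moved by (simp add: h_def)
  define dg where "dg = grad (f i) (x (Suc k) $ i) - grad (f i) (x k $ i)"
  define dis where "dis = (\<Sum>j\<in>UNIV. W $ i $ j *\<^sub>R (y k $ j - y k $ i))"
  have upper: "norm dg \<le> l * h" using smooth by (auto simp: L_smooth_def dg_def h_def)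
  have lower: "m * h \<le> norm dg"
    unfolding dg_def h_def using convex
    by (intro modulus_le_Lipschitz[where F = "f i"]) (auto simp: strongly_convex_def)
  have "dis = (\<Sum>j\<in>UNIV. W $ i $ j *\<^sub>R y k $ j) - y k $ i"
    using mixing_matrix_doubly_stochastic[OF W]
    by (simp add: dis_def doubly_stochastic_def scaleR_diff_right sum_subtractf flip: scaleR_sum_left)
  then have dy: "y (Suc k) $ i - y k $ i = dis + dg"
    using AdGT by (simp add: AdGT_common_def sum_over_neighbours[OF W] dg_def)
  have dis: "norm dis \<le> \<xi> * h" using disagreement by (simp add: dis_def h_def)
  have "norm (dis + dg) \<le> \<xi> * h + l * h" using dis upper norm_triangle_ineq[of dis dg] by linarith
  moreover have "m * h - \<xi> * h \<le> norm (dis + dg)" 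
    using dis lower norm_diff_ineq[of dg dis] by (simp add: add.commute)
  ultimately show "m \<le> Lf_est f x k i" "Lf_est f x k i \<le> l" "m - \<xi> \<le> Ly_est x y k i" "Ly_est x y k i \<le> l + \<xi>"
    using upper lower h
    by (simp_all add: Lf_est_def Ly_est_def dy flip: h_def dg_def) (simp_all add: field_simps)
qed

section \<open>Linear convergence of AdGT\<close>

theorem proposition1:
  fixes E :: "('n::finite \<times> 'n) set"
    and W :: "real ^ 'n ^ 'n"
    and f :: "'n \<Rightarrow> real ^ 'p \<Rightarrow> real"
    and Lc \<mu>c \<xi> :: "'n \<Rightarrow> real"
    and \<gamma> L \<mu> \<alpha>_low :: real
    and x y :: "nat \<Rightarrow> real ^ 'p ^ 'n"
    and \<alpha> \<theta> :: "nat \<Rightarrow> 'n \<Rightarrow> real"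
  assumes undirected: "sym E"
    and connected: "connected_graph E"
    and W: "mixing_matrix E W"
    and smooth: "\<And>i. L_smooth (Lc i) (f i)"
    and \<mu>_pos: "\<And>i. \<mu>c i > 0"
    and convex: "\<And>i. strongly_convex (\<mu>c i) (f i)"
    and \<gamma>_pos: "\<gamma> > 0"
    and AdGT: "AdGT_common E W f x y \<alpha> \<theta>"
    and \<xi>_nonneg: "\<And>i. \<xi> i \<ge> 0"
    and disagreement: "\<And>k i. norm (x (Suc k) $ i - x k $ i) > 0 \<Longrightarrow>
          norm (\<Sum>j\<in>UNIV. W $ i $ j *\<^sub>R (y k $ j - y k $ i))
            \<le> \<xi> i * norm (x (Suc k) $ i - x k $ i)"
    and first_move: "\<And>i. x 1 $ i \<noteq> x 0 $ i"
    and \<alpha>_init: "\<And>i. \<alpha> 0 i \<ge> 1 / (2 * \<gamma> * Lc i)"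
    and L: "L = (MAX i. Lc i)"
    and \<mu>: "\<mu> = (MIN i. \<mu>c i)"
    and \<alpha>_low: "\<alpha>_low = 1 / (2 * \<gamma> * (MAX i. Lc i + \<xi> i))"
  shows
    "(combined_update \<gamma> f x y \<alpha> \<theta> \<longrightarrow>
        (\<forall>i. \<forall>k\<ge>1. 1 / (2 * \<gamma> * (Lc i + \<xi> i)) \<le> \<alpha> k i \<and> \<alpha> k i \<le> 1 / (2 * \<gamma> * \<mu>c i)) \<and>
        (let r = real_spectral_radius (AdGT_matrix W L \<mu> \<alpha>_low (1 / (2 * \<gamma> * \<mu>)))
         in \<gamma> \<ge> L / \<mu> \<and> r < 1 \<longrightarrow>
              converges_linearly_near x (\<chi> i. avg_minimizer f) r))
     \<and>
     (tracking_update \<gamma> x y \<alpha> \<theta> \<longrightarrow>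
        (\<forall>i. \<forall>k\<ge>1. 1 / (2 * \<gamma> * (Lc i + \<xi> i)) \<le> \<alpha> k i) \<and>
        ((\<forall>i. \<xi> i < \<mu>c i) \<longrightarrow>
           (\<forall>i. \<forall>k\<ge>1. 1 / (2 * \<gamma> * (Lc i + \<xi> i)) \<le> \<alpha> k i \<and>
                        \<alpha> k i \<le> 1 / (2 * \<gamma> * (\<mu>c i - \<xi> i))) \<and>
           (let m = (MIN i. \<mu>c i - \<xi> i);
                r = real_spectral_radius (AdGT_matrix W L \<mu> \<alpha>_low (1 / (2 * \<gamma> * m)))
            in \<gamma> \<ge> L / m \<and> r < 1 \<longrightarrow>
                 converges_linearly_near x (\<chi> i. avg_minimizer f) r)))"
proof -
  have ds: "doubly_stochastic W" using W by (rule mixing_matrix_doubly_stochastic)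
  define g where "g i = grad (f i)" for i
  have conv_i: "f i y \<ge> f i x + g i x \<bullet> (y - x) + \<mu>c i / 2 * (norm (y - x))\<^sup>2" for i x y
    using convex[of i] by (simp add: strongly_convex_def g_def)
  have lip_i: "norm (g i u - g i v) \<le> Lc i * norm (u - v)" for i u v
    using smooth[of i] by (simp add: L_smooth_def g_def)
  \<comment> \<open>Comparing the two constants needs a pair of distinct points; the first move provides one.\<close>
  have \<mu>_le_Lc: "\<mu>c i \<le> Lc i" for i
  proof -
    have "\<mu>c i * norm (x 1 $ i - x 0 $ i) \<le> Lc i * norm (x 1 $ i - x 0 $ i)"
      using modulus_le_Lipschitz[where F = "f i", OF conv_i] lip_i by (rule order_trans)
    then show ?thesis using first_move[of i] by simp
  qed
  have Lc_pos: "0 < Lc i" for i using \<mu>_le_Lc[of i] \<mu>_pos[of i] by linarith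
  have L_ge: "Lc i \<le> L" and \<mu>_le: "\<mu> \<le> \<mu>c i" for i unfolding L \<mu> by auto
  have "\<mu> \<in> range \<mu>c" unfolding \<mu> by (intro Min_in) auto
  then have \<mu>0: "0 < \<mu>" using \<mu>_pos by auto
  have \<mu>L: "\<mu> \<le> L" using \<mu>_le \<mu>_le_Lc L_ge by (meson order_trans)
  have conv: "f i y \<ge> f i x + g i x \<bullet> (y - x) + \<mu> / 2 * (norm (y - x))\<^sup>2" for i x y
  proof -
    have "\<mu> / 2 * (norm (y - x))\<^sup>2 \<le> \<mu>c i / 2 * (norm (y - x))\<^sup>2"
      using \<mu>_le[of i] by (intro mult_right_mono) auto
    then show ?thesis using conv_i[of i x y] by linarith
  qed
  have lip: "norm (g i u - g i v) \<le> L * norm (u - v)" for i u v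
    using lip_i L_ge by (meson mult_right_mono norm_ge_zero order_trans)
  have Max_ge: "Lc i + \<xi> i \<le> (MAX i. Lc i + \<xi> i)" for i by auto
  have sum_pos: "0 < Lc i + \<xi> i" for i using Lc_pos[of i] \<xi>_nonneg[of i] by linarith
  have Max_pos: "0 < (MAX i. Lc i + \<xi> i)" using Max_ge sum_pos by (meson less_le_trans)
  have low_pos: "0 < \<alpha>_low" unfolding \<alpha>_low using Max_pos \<gamma>_pos by simp
  have low_le: "\<alpha>_low \<le> 1 / (2 * \<gamma> * (Lc i + \<xi> i))" for i
    unfolding \<alpha>_low using \<gamma>_pos sum_pos[of i] Max_ge[of i]
    by (intro divide_left_mono mult_left_mono mult_pos_pos) (auto intro: less_le_trans)
  have dis: "norm (\<Sum>j\<in>UNIV. W $ i $ j *\<^sub>R (y k $ j - y k $ i)) \<le> \<xi> i * norm (x (Suc k) $ i - x k $ i)"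
    if "x (Suc k) $ i \<noteq> x k $ i" for k i
    using that by (intro disagreement) simp
  have est: "\<mu>c i \<le> Lf_est f x k i" "Lf_est f x k i \<le> Lc i"
      "\<mu>c i - \<xi> i \<le> Ly_est x y k i" "Ly_est x y k i \<le> Lc i + \<xi> i"
    if "x (Suc k) $ i \<noteq> x k $ i" for k i
    by (rule estimate_bounds[OF AdGT W smooth convex dis[OF that] that])+
  have est_nonneg: "0 \<le> Lf_est f x k i" "0 \<le> Ly_est x y k i" for k i by (simp_all add: Lf_est_def Ly_est_def)
  have \<theta>: "\<theta> 0 i = 0" "\<theta> (Suc k) i = \<alpha> (Suc k) i / \<alpha> k i" for k i
    using AdGT by (simp_all add: AdGT_common_def)
  define b where "b i = 1 / (2 * \<gamma> * (Lc i + \<xi> i))" for i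
  have b_pos: "0 < b i" for i using \<gamma>_pos sum_pos[of i] by (simp add: b_def)
  have b_init: "b i \<le> \<alpha> 0 i" for i
  proof -
    have "b i \<le> 1 / (2 * \<gamma> * Lc i)" unfolding b_def using \<gamma>_pos Lc_pos[of i] sum_pos[of i] \<xi>_nonneg[of i]
      by (intro divide_left_mono mult_left_mono mult_pos_pos) auto
    then show ?thesis using \<alpha>_init[of i] by linarith
  qed
  have cand_f: "b i \<le> c" if "x (Suc k) $ i \<noteq> x k $ i" "c \<in> candidate \<gamma> (Lf_est f x k i)" for k i c
    unfolding b_def using est(2)[OF that(1)] \<xi>_nonneg[of i] est_nonneg
    by (intro candidate_lower_bound[OF that(2) \<gamma>_pos]) auto
  have cand_y: "b i \<le> c" if "x (Suc k) $ i \<noteq> x k $ i" "c \<in> candidate \<gamma> (Ly_est x y k i)" for k i c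
    unfolding b_def using est(4)[OF that(1)] est_nonneg
    by (intro candidate_lower_bound[OF that(2) \<gamma>_pos]) auto
  have moved0: "\<not> x (Suc 0) $ i = x 0 $ i" for i using first_move by simp
  have limit: "converges_linearly_near x (\<chi> i. avg_minimizer f)
      (real_spectral_radius (AdGT_matrix W L \<mu> \<alpha>_low (1 / (2 * \<gamma> * m))))"
    if m: "0 < m" "L / m \<le> \<gamma>"
      and bounds: "\<And>k i. b i \<le> \<alpha> (Suc k) i" "\<And>k i. \<alpha> (Suc k) i \<le> 1 / (2 * \<gamma> * m)" for m
  proof -
    have "2 * (1 / (2 * \<gamma> * m)) * L \<le> 1" using m \<gamma>_pos by (simp add: field_simps)
    moreover have "\<alpha>_low \<le> \<alpha> (Suc k) i" for k i using low_le[of i] bounds(1)[of i k] by (simp add: b_def)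
    ultimately show ?thesis
      unfolding const_rows_def[symmetric]
      using AdGT_stacked[OF AdGT W, folded g_def] bounds(2) low_pos
      by (intro gradient_tracking_linear_convergence[OF ds conv lip \<mu>0 \<mu>L]) auto
  qed
  have range_bound: "1 / (2 * \<gamma> * c) \<le> 1 / (2 * \<gamma> * m)" if "0 < m" "m \<le> c" for c m
    using that \<gamma>_pos by (intro divide_left_mono mult_left_mono mult_pos_pos) auto

  have combined: "b i \<le> \<alpha> k i" "\<alpha> (Suc k) i \<le> 1 / (2 * \<gamma> * \<mu>c i)"
    if upd: "combined_update \<gamma> f x y \<alpha> \<theta>" for k i
  proof -
    let ?C = "\<lambda>k. candidate \<gamma> (Lf_est f x k i) \<union> candidate \<gamma> (Ly_est x y k i)"
    have step: "\<alpha> (Suc k) i = (if x (Suc k) $ i = x k $ i then \<alpha> k i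
        else Min (?C k \<union> {sqrt (1 + \<theta> k i) * \<alpha> k i}))" for k
      using upd unfolding combined_update_def by blast
    show "b i \<le> \<alpha> k i"
      by (rule stepsize_lower_bound[where a = "\<lambda>k. \<alpha> k i" and t = "\<lambda>k. \<theta> k i" and C = ?C, OF step])
        (use \<theta> cand_f cand_y b_pos b_init in \<open>auto simp: finite_candidate\<close>)
    show "\<alpha> (Suc k) i \<le> 1 / (2 * \<gamma> * \<mu>c i)"
      by (rule stepsize_upper_bound[where a = "\<lambda>k. \<alpha> k i" and t = "\<lambda>k. \<theta> k i" and C = ?C, OF step])
        (use moved0 candidate_upper_bound[OF \<gamma>_pos \<mu>_pos est(1)] in \<open>auto simp: finite_candidate bex_Un\<close>)
  qed
  have tracking: "b i \<le> \<alpha> k i" "\<xi> i < \<mu>c i \<Longrightarrow> \<alpha> (Suc k) i \<le> 1 / (2 * \<gamma> * (\<mu>c i - \<xi> i))"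
    if upd: "tracking_update \<gamma> x y \<alpha> \<theta>" for k i
  proof -
    let ?C = "\<lambda>k. candidate \<gamma> (Ly_est x y k i)"
    have step: "\<alpha> (Suc k) i = (if x (Suc k) $ i = x k $ i then \<alpha> k i
        else Min (?C k \<union> {sqrt (1 + \<theta> k i) * \<alpha> k i}))" for k
      using upd unfolding tracking_update_def by blast
    show "b i \<le> \<alpha> k i"
      by (rule stepsize_lower_bound[where a = "\<lambda>k. \<alpha> k i" and t = "\<lambda>k. \<theta> k i" and C = ?C, OF step])
        (use \<theta> cand_y b_pos b_init in \<open>auto simp: finite_candidate\<close>)
    assume "\<xi> i < \<mu>c i"
    then have "0 < \<mu>c i - \<xi> i" by simp
    then show "\<alpha> (Suc k) i \<le> 1 / (2 * \<gamma> * (\<mu>c i - \<xi> i))"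
      by (intro stepsize_upper_bound[where a = "\<lambda>k. \<alpha> k i" and t = "\<lambda>k. \<theta> k i" and C = ?C, OF step])
        (use moved0 candidate_upper_bound[OF \<gamma>_pos _ est(3)] in \<open>auto simp: finite_candidate\<close>)
  qed
  have from_1: "(\<forall>k\<ge>1. P k) \<longleftrightarrow> (\<forall>k. P (Suc k))" for P :: "nat \<Rightarrow> bool"
    by (metis One_nat_def Suc_le_D Suc_le_mono zero_le)
  show ?thesis unfolding from_1 b_def[symmetric] Let_def
  proof (intro conjI impI allI)
    assume upd: "combined_update \<gamma> f x y \<alpha> \<theta>"
    note bounds = combined[OF upd]
    show "b i \<le> \<alpha> (Suc k) i" "\<alpha> (Suc k) i \<le> 1 / (2 * \<gamma> * \<mu>c i)" for i k by (rule bounds)+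
    show "converges_linearly_near x (\<chi> i. avg_minimizer f)
        (real_spectral_radius (AdGT_matrix W L \<mu> \<alpha>_low (1 / (2 * \<gamma> * \<mu>))))"
      if "L / \<mu> \<le> \<gamma> \<and> real_spectral_radius (AdGT_matrix W L \<mu> \<alpha>_low (1 / (2 * \<gamma> * \<mu>))) < 1"
      using that by (intro limit \<mu>0 bounds(1) order_trans[OF bounds(2) range_bound[OF \<mu>0 \<mu>_le]]) auto
  next
    assume upd: "tracking_update \<gamma> x y \<alpha> \<theta>"
    note bounds = tracking[OF upd]
    show "b i \<le> \<alpha> (Suc k) i" "b i \<le> \<alpha> (Suc k) i" for i k by (rule bounds)+
    assume small: "\<forall>i. \<xi> i < \<mu>c i"
    show "\<alpha> (Suc k) i \<le> 1 / (2 * \<gamma> * (\<mu>c i - \<xi> i))" for i k using small by (intro bounds) auto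
    define m where "m = (MIN i. \<mu>c i - \<xi> i)"
    have m_le: "m \<le> \<mu>c i - \<xi> i" for i by (auto simp: m_def)
    have "m \<in> range (\<lambda>i. \<mu>c i - \<xi> i)" unfolding m_def by (intro Min_in) auto
    then have m0: "0 < m" using small by auto
    assume "L / (MIN i. \<mu>c i - \<xi> i) \<le> \<gamma> \<and> real_spectral_radius (AdGT_matrix W L \<mu> \<alpha>_low
        (1 / (2 * \<gamma> * (MIN i. \<mu>c i - \<xi> i)))) < 1"
    then show "converges_linearly_near x (\<chi> i. avg_minimizer f)
        (real_spectral_radius (AdGT_matrix W L \<mu> \<alpha>_low (1 / (2 * \<gamma> * (MIN i. \<mu>c i - \<xi> i)))))"
      unfolding m_def[symmetric]
      using small by (intro limit m0 bounds(1) order_trans[OF bounds(2) range_bound[OF m0 m_le]]) auto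
  qed
qed

end
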